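(* For every $R>0$ there is a constant $C_R>0$ depending only on $R$ such that the following holds. Let $u=u_re_r+u_ze_z$ be a smooth axisymmetric velocity field on $\mathbb{R}^3$ without swirl satisfying $\nabla\cdot u=0$, with vorticity $\nabla\times u=w^\theta e_\theta$, and let $\tilde u=(u_r,u_z)$, regarded as a function of $(r,z)$ in the half plane $\mathbb{R}^2_+=\{(r,z): r>0\}$. Then for any $p\in(1,\infty)$, $$\|\tilde u\|_{L^p([0,R]\times[-R,R])}\le C_R\,\Big\|\frac{w^\theta}{r}\Big\|_{L^1\cap L^p(\mathbb{R}^3)},$$ where the norm on the left is taken with respect to the two-dimensional measure $dr\,dz$.
   Context: Cylindrical coordinates on $\mathbb{R}^3$ are $(r,\theta,z)$ with $e_r=(\cos\theta,\sin\theta,0)$, $e_\theta=(-\sin\theta,\cos\theta,0)$, $e_z=(0,0,1)$. An axisymmetric velocity field without swirl has the form $u=u_r(r,z)e_r+u_z(r,z)e_z$ (time, if present, is a parameter). Its vorticity is $\nabla\times u=w^\theta e_\theta$ with $w^\theta=w_\theta=\partial_z u_r-\partial_r u_z$. The norm on $L^1\cap L^p(\mathbb{R}^3)$ is $\|f\|_{L^1\cap L^p}=\|f\|_{L^1}+\|f\|_{L^p}$ with respect to Lebesgue measure on $\mathbb{R}^3$; the inequality is understood to be for fields with finite right-hand side. Standing assumption: $u$ is recovered from its vorticity, i.e. $u=\nabla\times(\psi e_\theta)$, where the stream function $\psi=\psi(r,z)$ vanishes on the axis $r=0$, satisfies $-\Delta(\psi e_\theta)=w^\theta e_\theta$, and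 is given by the absolutely convergent integral $\psi e_\theta(X)=\int_{\mathbb{R}^3}\frac{1}{4\pi|X-Y|}\,w^\theta(Y)e_\theta(Y)\,dY$. *)

theory Defs
  imports "HOL-Analysis.Analysis"
begin

definition partial_deriv :: "3 \<Rightarrow> (real^3 \<Rightarrow> real^3) \<Rightarrow> real^3 \<Rightarrow> real^3" where
  "partial_deriv i f X = frechet_derivative f (at X) (axis i 1)"

primrec C_class :: "nat \<Rightarrow> (real^3 \<Rightarrow> real^3) \<Rightarrow> bool" where
  "C_class 0 f \<longleftrightarrow> continuous_on UNIV f"
| "C_class (Suc k) f \<longleftrightarrow>
     (\<forall>X. f differentiable at X) \<and> (\<forall>i. C_class k (partial_deriv i f))"

definition smooth_field :: "(real^3 \<Rightarrow> real^3) \<Rightarrow> bool" where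
  "smooth_field f \<longleftrightarrow> (\<forall>k. C_class k f)"

definition divergence :: "(real^3 \<Rightarrow> real^3) \<Rightarrow> real^3 \<Rightarrow> real" where
  "divergence f X = (\<Sum>i\<in>UNIV. partial_deriv i f X $ i)"

definition curl :: "(real^3 \<Rightarrow> real^3) \<Rightarrow> real^3 \<Rightarrow> real^3" where
  "curl f X = vector
     [partial_deriv 2 f X $ 3 - partial_deriv 3 f X $ 2,
      partial_deriv 3 f X $ 1 - partial_deriv 1 f X $ 3,
      partial_deriv 1 f X $ 2 - partial_deriv 2 f X $ 1]"

definition vector_laplacian :: "(real^3 \<Rightarrow> real^3) \<Rightarrow> real^3 \<Rightarrow> real^3" where
  "vector_laplacian f X = (\<Sum>i\<in>UNIV. partial_deriv i (partial_deriv i f) X)"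

definition cyl_r :: "real^3 \<Rightarrow> real" where
  "cyl_r X = sqrt ((X $ 1)\<^sup>2 + (X $ 2)\<^sup>2)"

abbreviation cyl_z :: "real^3 \<Rightarrow> real" where
  "cyl_z X \<equiv> X $ 3"

(* The cylindrical frame as a function of the point, with cos \<theta> and sin \<theta> written as
   X$1 / r and X$2 / r.  As x / 0 = 0, e_r and e_theta are 0 on the axis, where \<theta> is undefined. *)

definition e_r :: "real^3 \<Rightarrow> real^3" where
  "e_r X = vector [X $ 1 / cyl_r X, X $ 2 / cyl_r X, 0]"

definition e_theta :: "real^3 \<Rightarrow> real^3" where
  "e_theta X = vector [- (X $ 2) / cyl_r X, X $ 1 / cyl_r X, 0]"

definition e_z :: "real^3" where
  "e_z = vector [0, 0, 1]"

(* Only the values of ur, uz (and of w, psi below) at radii r \<ge> 0 matter. *)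
definition axisymmetric_no_swirl ::
    "(real^3 \<Rightarrow> real^3) \<Rightarrow> (real \<Rightarrow> real \<Rightarrow> real) \<Rightarrow> (real \<Rightarrow> real \<Rightarrow> real) \<Rightarrow> bool" where
  "axisymmetric_no_swirl u ur uz \<longleftrightarrow>
     (\<forall>X. u X = ur (cyl_r X) (cyl_z X) *\<^sub>R e_r X + uz (cyl_r X) (cyl_z X) *\<^sub>R e_z)"

definition azimuthal_field :: "(real \<Rightarrow> real \<Rightarrow> real) \<Rightarrow> real^3 \<Rightarrow> real^3" where
  "azimuthal_field g X = g (cyl_r X) (cyl_z X) *\<^sub>R e_theta X"

(* The C^2 clause makes the Laplacian and the curl of psi e_theta classical derivatives;
   frechet_derivative is an arbitrary value where a function is not differentiable. *)
definition is_stream_function ::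
    "(real \<Rightarrow> real \<Rightarrow> real) \<Rightarrow> (real \<Rightarrow> real \<Rightarrow> real) \<Rightarrow> (real^3 \<Rightarrow> real^3) \<Rightarrow> bool" where
  "is_stream_function psi w u \<longleftrightarrow>
     (\<forall>z. psi 0 z = 0) \<and>
     C_class 2 (azimuthal_field psi) \<and>
     (\<forall>X. u X = curl (azimuthal_field psi) X) \<and>
     (\<forall>X. - vector_laplacian (azimuthal_field psi) X = azimuthal_field w X) \<and>
     (\<forall>X. integrable lborel (\<lambda>Y. (1 / (4 * pi * norm (X - Y))) *\<^sub>R azimuthal_field w Y) \<and>
          azimuthal_field psi X =
            (\<integral>Y. (1 / (4 * pi * norm (X - Y))) *\<^sub>R azimuthal_field w Y \<partial>lborel))"

definition Lp_norm :: "'a measure \<Rightarrow> real \<Rightarrow> ('a \<Rightarrow> 'b::real_normed_vector) \<Rightarrow> ennreal" where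
  "Lp_norm M p f =
     (let I = (\<integral>\<^sup>+ x. ennreal (norm (f x) powr p) \<partial>M)
      in if I = \<infinity> then \<infinity> else ennreal (enn2real I powr (1 / p)))"

definition L1_Lp_norm :: "'a measure \<Rightarrow> real \<Rightarrow> ('a \<Rightarrow> 'b::real_normed_vector) \<Rightarrow> ennreal" where
  "L1_Lp_norm M p f = Lp_norm M 1 f + Lp_norm M p f"

end

theory Submission
  imports Defs
begin

text \<open>
  Write g = |w / r|, let A = psi e_theta be the stream field and X = (x, 0, z) a point of the
  half plane.  The velocity is a combination of first derivatives of A, and A is the Newtonian
  potential of w e_theta, whose length at Y is r(Y) g(Y).  Therefore u(X) is controlled by the
  integral of g(Y) r(Y) / |X - Y|^2.  Three observations turn this into the estimate.

  First, the potential is never differentiated under the integral sign.  Since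
  |1/|X - Y| - 1/|X' - Y|| \<le> |X - X'| (1/|X - Y|^2 + 1/|X' - Y|^2), every difference quotient of A
  is bounded by the integral above, taken at X and at X'
  (\<open>newtonian_difference_quotient_le\<close>).  The velocity on the half plane is a limit of such quotients
  with both end points in the plane of X: u_r = - dpsi/dz and u_z = dpsi/dr + psi/r, where psi/r
  is, up to sign, the quotient between X and its mirror image (-x, 0, z)
  (\<open>slice_velocity_le\<close>).  So an L^p bound for the quotients, uniform in the step, passes to the
  velocity by Fatou's lemma.

  Second, where |X - Y| \<ge> 1 the kernel r(Y) / |X - Y|^2 is bounded, because
  r(Y) \<le> r(X) + |X - Y|; this part contributes the L^1 norm of g.  What remains is the kernel
  \<open>near_kernel\<close> cut off to |X_i - Y_i| < 1 (\<open>Biot_Savart_kernel_le_near_kernel\<close>).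

  Third, the near kernel maps L^p(R^3) to L^p(dx dz) by the Schur test: it is enough to bound its
  integral in Y for fixed X (\<open>nn_integral_near_kernel_le\<close>), and, against the axisymmetric function
  g^p, its integral in (x, z) (\<open>plane_integral_near_kernel_le\<close>).  Both follow from
  1/|Z|^2 \<le> |Z_1|^(-2/3) |Z_2|^(-2/3) |Z_3|^(-2/3), whose factors are integrable one at a time.
  In the second bound Y_2 is not integrated over and a factor r(Y) |Y_2|^(-2/3) survives; it becomes
  bounded after averaging over rotations about the axis, which leave g unchanged.
  The resulting constant has the form C^p before the p-th root is taken, so C does not depend on p.
\<close>

section \<open>Schur test\<close>

text \<open>
  Hoelder's inequality for the weight k, in the form that the Schur test uses.  The number d only has
  to lie below the integral of g k, so an infinite integral needs no separate treatment by the
  caller.  The proof integrates Young's inequality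
  g \<le> t^(1-p) g^p / p + t (1 - 1/p) against k and then optimizes the free parameter t.
\<close>

lemma nn_integral_powr_weighted_le:
  fixes g k :: "'a \<Rightarrow> real"
  assumes [measurable]: "g \<in> borel_measurable M" "k \<in> borel_measurable M"
    and nonneg: "\<And>y. 0 \<le> g y" "\<And>y. 0 \<le> k y"
    and A: "(\<integral>\<^sup>+y. k y \<partial>M) \<le> ennreal A" "A > 0"
    and d: "0 \<le> d" "ennreal d \<le> (\<integral>\<^sup>+y. ennreal (g y * k y) \<partial>M)" and p: "1 < p"
  shows "ennreal (d powr p) \<le> ennreal (A powr (p - 1)) * (\<integral>\<^sup>+y. ennreal (g y powr p * k y) \<partial>M)"
proof (cases "(\<integral>\<^sup>+y. ennreal (g y powr p * k y) \<partial>M)")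
  case top
  then show ?thesis using A by (simp add: ennreal_mult_top)
next
  case (real I)
  define q where "q = p / (p - 1)"
  have q: "1 < q" "1 / p + 1 / q = 1" using p by (auto simp: q_def field_simps)
  have key: "d \<le> I * t powr (1 - p) / p + t * A / q" if t: "t > 0" for t
  proof -
    have young: "g y * k y \<le> (g y powr p * k y) * (t powr (1 - p) / p) + k y * (t / q)" for y
    proof -
      have "(t powr (- (1 / q)) * g y) * t powr (1 / q)
          \<le> (t powr (- (1 / q)) * g y) powr p / p + (t powr (1 / q)) powr q / q"
        using p q nonneg by (intro Youngs_inequality) auto
      moreover have "(t powr (- (1 / q)) * g y) * t powr (1 / q) = g y"
        using t by (simp add: powr_minus field_simps)
      moreover have "(t powr (- (1 / q)) * g y) powr p = t powr (1 - p) * g y powr p"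
      proof -
        have "- (1 / q) * p = 1 - p" using p by (simp add: q_def field_simps)
        then show ?thesis using t nonneg by (simp add: powr_mult powr_powr)
      qed
      moreover have "(t powr (1 / q)) powr q = t" using t q by (simp add: powr_powr)
      ultimately have "g y \<le> t powr (1 - p) * g y powr p / p + t / q" by simp
      from mult_right_mono[OF this nonneg(2)[of y]] show ?thesis
        by (simp add: algebra_simps)
    qed
    have "ennreal d \<le> (\<integral>\<^sup>+y. ennreal (g y powr p * k y) * ennreal (t powr (1 - p) / p)
                          + ennreal (k y) * ennreal (t / q) \<partial>M)"
      using p q t nonneg young
      by (intro order_trans[OF d(2)] nn_integral_mono)
         (simp add: ennreal_mult[symmetric] ennreal_plus[symmetric] ennreal_leI del: ennreal_plus)
    also have "\<dots> = ennreal I * ennreal (t powr (1 - p) / p) + (\<integral>\<^sup>+y. k y \<partial>M) * ennreal (t / q)"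
      by (simp add: nn_integral_add nn_integral_multc real)
    also have "\<dots> \<le> ennreal I * ennreal (t powr (1 - p) / p) + ennreal A * ennreal (t / q)"
      by (intro add_mono mult_right_mono A) auto
    also have "\<dots> = ennreal (I * t powr (1 - p) / p + t * A / q)"
      using real A p q t by (simp add: ennreal_mult[symmetric] ennreal_plus[symmetric] mult_ac del: ennreal_plus)
    finally have "ennreal d \<le> ennreal (I * t powr (1 - p) / p + t * A / q)" .
    moreover have "0 \<le> I * t powr (1 - p) / p + t * A / q"
      using real A p q t by (intro add_nonneg_nonneg divide_nonneg_nonneg mult_nonneg_nonneg) auto
    ultimately show ?thesis by (simp only: ennreal_le_iff)
  qed
  have "d \<le> A powr ((p - 1) / p) * I powr (1 / p)"
  proof (cases "I = 0")
    case False
    \<comment> \<open>the minimizer, at which both summands of the bound are multiples of t A\<close>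
    define t where "t = (I / A) powr (1 / p)"
    have t: "t > 0" using False real A by (simp add: t_def)
    have tp: "t powr p = I / A" using p A real False by (simp add: t_def powr_powr)
    have I: "I * t powr (1 - p) = t * A"
      using tp t A by (simp add: powr_diff field_simps)
    have "d \<le> t * A * (1 / p + 1 / q)" using key[OF t] I by (simp add: algebra_simps)
    also have "\<dots> = A powr ((p - 1) / p) * I powr (1 / p)"
    proof -
      have "(p - 1) / p = 1 - 1 / p" using p by (simp add: field_simps)
      then show ?thesis using q A real False
        by (simp add: t_def powr_divide powr_diff)
    qed
    finally show ?thesis .
  next
    case True
    have "d \<le> 0"
    proof (rule field_le_epsilon)
      fix e :: real assume "0 < e"
      then show "d \<le> 0 + e" using key[of "e * q / A"] True A q by simp
    qed
    then show ?thesis using True by simp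
  qed
  then have "d powr p \<le> (A powr ((p - 1) / p) * I powr (1 / p)) powr p"
    using d p by (intro powr_mono2) auto
  also have "\<dots> = A powr (p - 1) * I"
    using p A real by (simp add: powr_mult powr_powr)
  finally show ?thesis using real A by (simp add: ennreal_mult[symmetric])
qed

section \<open>Rotation invariance of Lebesgue measure\<close>

text \<open>
  Lebesgue measure is determined by its values on boxes, and an orthogonal map preserves the
  measure of the preimage of a box.
\<close>

lemma distr_lborel_orthogonal:
  fixes f :: "real^'n::{finite,wellorder} \<Rightarrow> real^'n::_"
  assumes f: "orthogonal_transformation f"
  shows "distr lborel borel f = lborel"
proof (rule lborel_eqI[symmetric])
  have lin: "linear f" "linear (inv f)" and bij: "bij f"
    using f orthogonal_transformation_linear orthogonal_transformation_inv
      orthogonal_transformation_bij by blast+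
  have [measurable]: "f \<in> borel_measurable borel"
    using lin(1) by (simp add: borel_measurable_continuous_onI linear_continuous_on linear_conv_bounded_linear)
  fix l u :: "real^'n::{finite,wellorder}" assume lu: "\<And>b. b \<in> Basis \<Longrightarrow> l \<bullet> b \<le> u \<bullet> b"
  have vim: "f -` box l u = inv f ` box l u"
    using bij by (simp add: bij_vimage_eq_inv_image)
  have inv: "orthogonal_transformation (inv f)"
    using f orthogonal_transformation_inv by blast
  have "inv f ` box l u \<in> lmeasurable" "measure lebesgue (inv f ` box l u) = measure lebesgue (box l u)"
    using measurable_orthogonal_image[OF inv] measure_orthogonal_image[OF inv] by auto
  then have "emeasure lebesgue (inv f ` box l u) = emeasure lebesgue (box l u)"
    by (simp add: emeasure_eq_measure2 fmeasurableD2)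
  moreover have "f -` box l u \<in> sets borel"
    using measurable_sets[OF \<open>f \<in> borel_measurable borel\<close>, of "box l u"] by simp
  ultimately have "emeasure lborel (f -` box l u) = emeasure lborel (box l u)"
    using vim by simp
  then show "emeasure (distr lborel borel f) (box l u) = (\<Prod>b\<in>Basis. (u - l) \<bullet> b)"
    using lu by (subst emeasure_distr) (auto simp: emeasure_lborel_box)
qed simp

lemma nn_integral_lborel_orthogonal:
  fixes f :: "real^'n::{finite,wellorder} \<Rightarrow> real^'n::_"
  assumes f: "orthogonal_transformation f" and h[measurable]: "h \<in> borel_measurable borel"
  shows "(\<integral>\<^sup>+Y. h (f Y) \<partial>lborel) = (\<integral>\<^sup>+Y. h Y \<partial>lborel)"
proof -
  have [measurable]: "f \<in> borel_measurable borel"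
    using orthogonal_transformation_linear[OF f]
    by (simp add: borel_measurable_continuous_onI linear_continuous_on linear_conv_bounded_linear)
  have "(\<integral>\<^sup>+Y. h Y \<partial>lborel) = (\<integral>\<^sup>+Y. h Y \<partial>distr lborel borel f)"
    by (simp add: distr_lborel_orthogonal[OF f])
  also have "\<dots> = (\<integral>\<^sup>+Y. h (f Y) \<partial>lborel)"
    by (subst nn_integral_distr) auto
  finally show ?thesis ..
qed

section \<open>Cylindrical coordinates and the near part of the Biot-Savart kernel\<close>

lemma borel_measurable_vec_nth [measurable (raw)]:
  fixes f :: "'a \<Rightarrow> real^'n"
  assumes "f \<in> borel_measurable M"
  shows "(\<lambda>x. f x $ i) \<in> borel_measurable M"
proof -
  have "(\<lambda>v::real^'n. v $ i) \<in> borel_measurable borel"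
    by (intro borel_measurable_continuous_onI continuous_intros)
  from measurable_compose[OF assms this] show ?thesis .
qed

lemma cyl_r_measurable [measurable]: "cyl_r \<in> borel_measurable borel"
  unfolding cyl_r_def by measurable

lemma cyl_r_nonneg [simp]: "0 \<le> cyl_r Y" by (simp add: cyl_r_def)

lemma norm_vec3: "norm (Z :: real^3) = sqrt ((Z$1)\<^sup>2 + (Z$2)\<^sup>2 + (Z$3)\<^sup>2)"
  by (simp add: norm_vec_def L2_set_def sum_3)

text \<open>
  The radius is the norm of the horizontal part, hence 1-Lipschitz.
\<close>

lemma cyl_r_le_add_norm: "cyl_r Y \<le> cyl_r X + norm (X - Y)"
proof -
  have "cyl_r Y = norm (vector [Y$1, Y$2, 0] :: real^3)" by (simp add: cyl_r_def norm_vec3)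
  also have "\<dots> \<le> norm (vector [X$1, X$2, 0] :: real^3) + norm (vector [Y$1, Y$2, 0] - vector [X$1, X$2, 0] :: real^3)"
    using norm_triangle_ineq[of "vector [X$1, X$2, 0] :: real^3" "vector [Y$1, Y$2, 0] - vector [X$1, X$2, 0]"]
    by simp
  also have "norm (vector [X$1, X$2, 0] :: real^3) = cyl_r X" by (simp add: cyl_r_def norm_vec3)
  also have "norm (vector [Y$1, Y$2, 0] - vector [X$1, X$2, 0] :: real^3) \<le> norm (X - Y)"
    by (simp add: norm_vec3 power2_commute)
  finally show ?thesis by simp
qed

definition cut_singularity :: "real \<Rightarrow> real" where
  "cut_singularity t = (if \<bar>t\<bar> < 1 then \<bar>t\<bar> powr (-2/3) else 0)"

lemma cut_singularity_nonneg [simp]: "0 \<le> cut_singularity t" by (simp add: cut_singularity_def)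

lemma cut_singularity_measurable [measurable]: "cut_singularity \<in> borel_measurable borel"
  unfolding cut_singularity_def by measurable

lemma nn_integral_cut_singularity: "(\<integral>\<^sup>+t. cut_singularity t \<partial>lborel) \<le> 6"
proof -
  define h :: "real \<Rightarrow> real" where "h t = t powr (-2/3) * indicator {0..1} t" for t
  have [measurable]: "h \<in> borel_measurable borel" unfolding h_def by measurable
  have "((\<lambda>t. t powr (-2/3)) has_integral (1 powr (-2/3 + 1) / (-2/3 + 1))) {0..1::real}"
    by (rule has_integral_powr_from_0) auto
  then have I: "(\<integral>\<^sup>+t. h t \<partial>lborel) = ennreal 3"
    using nn_integral_has_integral_lebesgue[of "{0..1}" "\<lambda>t. t powr (-2/3)" 3]
    by (simp add: h_def mult.commute)
  have "(\<integral>\<^sup>+t. cut_singularity t \<partial>lborel) \<le> (\<integral>\<^sup>+t. ennreal (h t) + ennreal (h (0 + (-1) * t)) \<partial>lborel)"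
    by (intro nn_integral_mono) (auto simp: cut_singularity_def h_def indicator_def)
  also have "\<dots> = (\<integral>\<^sup>+t. h t \<partial>lborel) + (\<integral>\<^sup>+t. h (0 + (-1) * t) \<partial>lborel)"
    by (rule nn_integral_add) auto
  also have "(\<integral>\<^sup>+t. h (0 + (-1) * t) \<partial>lborel) = (\<integral>\<^sup>+t. h t \<partial>lborel)"
    by (subst nn_integral_real_affine[of "\<lambda>t. ennreal (h t)" "-1" 0]) auto
  finally show ?thesis using I by (simp add: ennreal_plus[symmetric] del: ennreal_plus)
qed

lemma nn_integral_cut_singularity_affine:
  assumes "\<bar>c\<bar> = 1"
  shows "(\<integral>\<^sup>+t. cut_singularity (a + c * t) \<partial>lborel) \<le> 6"
  using nn_integral_cut_singularity assms
  by (subst (asm) nn_integral_real_affine[of "\<lambda>t. ennreal (cut_singularity t)" c a]) auto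

text \<open>
  The Biot-Savart kernel r(Y) / |X - Y|^2 restricted to |X_i - Y_i| < 1.  The cutoff r(Y) \<le> L is
  put on Y, and not on X, so that the kernel can be integrated over all X = (x, 0, z)
  with an integral that translations and reflections of that plane preserve.
\<close>

definition near_kernel :: "real \<Rightarrow> real^3 \<Rightarrow> real^3 \<Rightarrow> real" where
  "near_kernel L X Y = (if \<bar>X$1 - Y$1\<bar> < 1 \<and> \<bar>X$2 - Y$2\<bar> < 1 \<and> \<bar>X$3 - Y$3\<bar> < 1 \<and> cyl_r Y \<le> L
     then cyl_r Y / (norm (X - Y))\<^sup>2 else 0)"

lemma near_kernel_nonneg [simp]: "0 \<le> near_kernel L X Y" by (simp add: near_kernel_def)

lemma near_kernel_measurable [measurable (raw)]:
  assumes [measurable]: "f \<in> borel_measurable M" "g \<in> borel_measurable M"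
  shows "(\<lambda>x. near_kernel L (f x) (g x)) \<in> borel_measurable M"
  unfolding near_kernel_def by measurable

text \<open>
  Where the near kernel is cut off, |X - Y| \<ge> 1: either some coordinate differs by at least 1, or
  r(Y) > L \<ge> r(X) + 2.  There r(Y) \<le> r(X) + |X - Y| gives a bound of the kernel by r(X) + 1.
\<close>

lemma Biot_Savart_kernel_le_near_kernel:
  assumes "cyl_r X \<le> L - 2" "2 \<le> L"
  shows "cyl_r Y / (norm (X - Y))\<^sup>2 \<le> near_kernel L X Y + L"
proof (cases "1 \<le> norm (X - Y)")
  case True
  let ?d = "norm (X - Y)"
  have "cyl_r Y \<le> (L - 2) + ?d" using cyl_r_le_add_norm[of Y X] assms by simp
  also have "\<dots> \<le> (L - 2) * ?d\<^sup>2 + ?d\<^sup>2"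
  proof (intro add_mono)
    have *: "?d \<le> ?d\<^sup>2" using True power_increasing[of 1 2 ?d] by simp
    then have "1 \<le> ?d\<^sup>2" using True by linarith
    then show "L - 2 \<le> (L - 2) * ?d\<^sup>2" using assms mult_left_mono[of 1 "?d\<^sup>2" "L - 2"] by simp
    show "?d \<le> ?d\<^sup>2" by fact
  qed
  finally have "cyl_r Y / ?d\<^sup>2 \<le> L - 1" 
    using True by (intro divide_le_eq[THEN iffD2]) (auto simp: algebra_simps)
  then show ?thesis using near_kernel_nonneg[of L X Y] by linarith
next
  case False
  have "\<bar>X$i - Y$i\<bar> < 1" for i
    using False component_le_norm_cart[of "X - Y" i] by simp
  moreover have "cyl_r Y \<le> L" using cyl_r_le_add_norm[of Y X] assms False by linarith
  ultimately show ?thesis using assms by (simp add: near_kernel_def)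
qed

text \<open>
  Each |Z_i| is at most |Z|, and the three exponents add up to -2.  Splitting the exponent evenly
  keeps every factor integrable at 0 in one variable, so that Fubini replaces
  spherical coordinates.
\<close>

lemma inverse_norm_sq_le_prod:
  fixes Z :: "real^3"
  assumes "Z$1 \<noteq> 0" "Z$2 \<noteq> 0" "Z$3 \<noteq> 0"
  shows "1 / (norm Z)\<^sup>2 \<le> \<bar>Z$1\<bar> powr (-2/3) * \<bar>Z$2\<bar> powr (-2/3) * \<bar>Z$3\<bar> powr (-2/3)"
proof -
  have pos: "norm Z > 0" using assms by auto
  have c: "norm Z powr (-2/3) \<le> \<bar>Z$i\<bar> powr (-2/3)" if "Z$i \<noteq> 0" for i
    using that component_le_norm_cart[of Z i] by (intro powr_mono2') auto
  have "1 / (norm Z)\<^sup>2 = norm Z powr (-2)"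
    using pos by (simp add: powr_minus powr_numeral divide_inverse)
  also have "\<dots> = norm Z powr (-2/3) * norm Z powr (-2/3) * norm Z powr (-2/3)"
    using pos by (simp add: powr_add[symmetric])
  also have "\<dots> \<le> \<bar>Z$1\<bar> powr (-2/3) * \<bar>Z$2\<bar> powr (-2/3) * \<bar>Z$3\<bar> powr (-2/3)"
    using assms by (intro mult_mono c) auto
  finally show ?thesis .
qed

lemma AE_lborel_inner_neq:
  assumes "k \<in> Basis"
  shows "AE x in lborel. x \<bullet> k \<noteq> c"
proof -
  have "{x. x \<bullet> k = c} \<in> null_sets lebesgue"
    using negligible_standard_hyperplane[OF assms, of c] by (simp add: negligible_iff_null_sets)
  moreover have "{x. x \<bullet> k = c} \<in> sets lborel"
    by measurable
  ultimately have "{x. x \<bullet> k = c} \<in> null_sets lborel"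
    by (auto simp: null_sets_def)
  from AE_not_in[OF this] show ?thesis by simp
qed

text \<open>
  The product bound on 1/|Z|^2 degenerates where a coordinate of Z vanishes, since 0 powr a = 0;
  these hyperplanes are discarded as null sets.
\<close>

lemma AE_lborel_component_neq:
  fixes c :: real
  shows "AE Y in lborel :: (real^'n) measure. Y $ i \<noteq> c"
  using AE_lborel_inner_neq[of "axis i (1::real)" c] by (simp add: axis_in_Basis_iff inner_axis)

text \<open>
  First half of the Schur test.  The integral over the cube factorizes into three one-dimensional
  integrals, each at most 6, and r(Y) \<le> L.
\<close>

lemma nn_integral_near_kernel_le:
  assumes "0 \<le> L"
  shows "(\<integral>\<^sup>+Y. near_kernel L X Y \<partial>lborel) \<le> ennreal (216 * L)"
proof -
  have ax: "axis i (1::real) \<in> Basis" for i :: 3 by (simp add: axis_in_Basis_iff)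
  have bas: "(Basis :: (real^3) set) = {axis 1 1, axis 2 1, axis 3 1}"
    by (auto simp: Basis_vec_def UNIV_3)
  have neq: "axis 1 (1::real) \<noteq> (axis 2 1 :: real^3)" "axis 1 (1::real) \<noteq> (axis 3 1 :: real^3)"
    "axis 2 (1::real) \<noteq> (axis 3 1 :: real^3)" by (auto simp: axis_eq_axis)
  have "AE Y in lborel. near_kernel L X Y \<le> L * (\<Prod>b\<in>Basis. cut_singularity (X \<bullet> b - Y \<bullet> b))"
    using AE_lborel_component_neq[of 1 "X$1"] AE_lborel_component_neq[of 2 "X$2"]
      AE_lborel_component_neq[of 3 "X$3"]
  proof eventually_elim
    case (elim Y)
    show ?case
    proof (cases "near_kernel L X Y = 0")
      case True
      then show ?thesis using assms by (simp add: prod_nonneg)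
    next
      case False
      then have *: "\<bar>X$1 - Y$1\<bar> < 1" "\<bar>X$2 - Y$2\<bar> < 1" "\<bar>X$3 - Y$3\<bar> < 1" "cyl_r Y \<le> L"
        by (auto simp: near_kernel_def split: if_splits)
      have "near_kernel L X Y = cyl_r Y * (1 / (norm (X - Y))\<^sup>2)" using * by (simp add: near_kernel_def)
      also have "\<dots> \<le> L * (\<bar>(X - Y)$1\<bar> powr (-2/3) * \<bar>(X - Y)$2\<bar> powr (-2/3) * \<bar>(X - Y)$3\<bar> powr (-2/3))"
        using * elim assms by (intro mult_mono inverse_norm_sq_le_prod) simp_all
      also have "\<dots> = L * (\<Prod>b\<in>Basis. cut_singularity (X \<bullet> b - Y \<bullet> b))"
        using * neq by (simp add: bas cut_singularity_def inner_axis)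
      finally show ?thesis .
    qed
  qed
  then have "(\<integral>\<^sup>+Y. near_kernel L X Y \<partial>lborel)
      \<le> (\<integral>\<^sup>+Y. ennreal L * ennreal (\<Prod>b\<in>Basis. cut_singularity (X \<bullet> b - Y \<bullet> b)) \<partial>lborel)"
    by (intro nn_integral_mono_AE) (auto simp: ennreal_mult[symmetric] assms prod_nonneg elim: eventually_mono)
  also have "\<dots> = ennreal L * (\<Prod>b\<in>Basis. (\<integral>\<^sup>+t. cut_singularity (X \<bullet> b - t) \<partial>lborel))"
    using nn_integral_lborel_prod[of "\<lambda>b t. cut_singularity (X \<bullet> b - t)"]
    by (subst nn_integral_cmult) (auto simp: prod_ennreal[symmetric])
  also have "(\<Prod>b\<in>Basis. (\<integral>\<^sup>+t. cut_singularity (X \<bullet> b - t) \<partial>lborel)) \<le> 6 * (6 * 6)"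
  proof -
    have "(\<integral>\<^sup>+t. cut_singularity (c - t) \<partial>lborel) \<le> 6" for c
      using nn_integral_cut_singularity_affine[of "-1" c] by simp
    then show ?thesis
      using neq by (simp only: bas) (simp only: prod.insert finite.intros insert_iff empty_iff
        prod.empty mult_1_right simp_thms not_False_eq_True, intro mult_mono, auto)
  qed
  also have "ennreal L * (6 * (6 * 6)) = ennreal (216 * L)"
    using assms by (simp add: ennreal_mult'' mult.commute)
  finally show ?thesis by (simp add: mult_left_mono)
qed

section \<open>Integrating the near kernel over the meridian plane\<close>

definition slice_pt :: "real \<Rightarrow> real \<Rightarrow> real^3" where
  "slice_pt x z = vector [x, 0, z]"

lemma slice_pt_nth [simp]: "slice_pt x z $ 1 = x" "slice_pt x z $ 2 = 0" "slice_pt x z $ 3 = z"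
  by (simp_all add: slice_pt_def)

lemma slice_pt_eq: "slice_pt x z = x *\<^sub>R axis 1 1 + z *\<^sub>R axis 3 1"
  by (simp add: vec_eq_iff forall_3 axis_def)

lemma cyl_r_slice_pt [simp]: "cyl_r (slice_pt x z) = \<bar>x\<bar>"
  by (simp add: cyl_r_def)

lemma slice_pt_measurable [measurable (raw)]:
  assumes [measurable]: "f \<in> borel_measurable M" "g \<in> borel_measurable M"
  shows "(\<lambda>y. slice_pt (f y) (g y)) \<in> borel_measurable M"
  unfolding slice_pt_eq by measurable

text \<open>
  What is left of the near kernel after integration over the plane of all (x, 0, z): the factor
  |Y_2|^(-2/3) of the product bound, together with r(Y).
\<close>

definition slice_weight :: "real \<Rightarrow> real^3 \<Rightarrow> real" where
  "slice_weight L Y = (if cyl_r Y \<le> L then cyl_r Y else 0) * \<bar>Y$2\<bar> powr (-2/3)"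

lemma slice_weight_nonneg [simp]: "0 \<le> slice_weight L Y" by (simp add: slice_weight_def)

lemma slice_weight_measurable [measurable]: "slice_weight L \<in> borel_measurable borel"
  unfolding slice_weight_def by measurable

text \<open>
  The factors in x - Y_1 and z - Y_3 of the product bound are integrated out; the one in
  Y_2 stays.
\<close>

lemma nn_integral_near_kernel_slice_le:
  assumes "Y$2 \<noteq> 0"
  shows "(\<integral>\<^sup>+x. \<integral>\<^sup>+z. near_kernel L (slice_pt x z) Y \<partial>lborel \<partial>lborel) \<le> ennreal (36 * slice_weight L Y)"
proof -
  have pointwise: "near_kernel L (slice_pt x z) Y \<le> slice_weight L Y * cut_singularity (x - Y$1) * cut_singularity (z - Y$3)"
    if "x \<noteq> Y$1" "z \<noteq> Y$3" for x z
  proof (cases "near_kernel L (slice_pt x z) Y = 0")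
    case False
    let ?Z = "slice_pt x z - Y"
    from False have *: "\<bar>x - Y$1\<bar> < 1" "\<bar>z - Y$3\<bar> < 1" "cyl_r Y \<le> L"
      by (auto simp: near_kernel_def split: if_splits)
    have "near_kernel L (slice_pt x z) Y \<le> cyl_r Y * (1 / (norm ?Z)\<^sup>2)"
      by (simp add: near_kernel_def)
    also have "\<dots> \<le> cyl_r Y * (\<bar>?Z$1\<bar> powr (-2/3) * \<bar>?Z$2\<bar> powr (-2/3) * \<bar>?Z$3\<bar> powr (-2/3))"
      using that assms by (intro mult_left_mono inverse_norm_sq_le_prod) auto
    also have "\<dots> = slice_weight L Y * cut_singularity (x - Y$1) * cut_singularity (z - Y$3)"
      using * by (simp add: cut_singularity_def slice_weight_def)
    finally show ?thesis .
  qed simp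
  have sing6: "(\<integral>\<^sup>+t. cut_singularity (t - c) \<partial>lborel) \<le> 6" for c
    using nn_integral_cut_singularity_affine[of 1 "-c"] by (simp add: add.commute)
  have "(\<integral>\<^sup>+x. \<integral>\<^sup>+z. near_kernel L (slice_pt x z) Y \<partial>lborel \<partial>lborel)
     \<le> (\<integral>\<^sup>+x. \<integral>\<^sup>+z. ennreal (slice_weight L Y * cut_singularity (x - Y$1)) * cut_singularity (z - Y$3) \<partial>lborel \<partial>lborel)"
  proof (rule nn_integral_mono_AE, use AE_lborel_singleton[of "Y$1"] in eventually_elim)
    case (elim x)
    show ?case
      by (rule nn_integral_mono_AE, use AE_lborel_singleton[of "Y$3"] in eventually_elim)
         (simp add: pointwise elim ennreal_leI flip: ennreal_mult)
  qed
  also have "\<dots> = (\<integral>\<^sup>+x. ennreal (slice_weight L Y) * cut_singularity (x - Y$1) * (\<integral>\<^sup>+z. cut_singularity (z - Y$3) \<partial>lborel) \<partial>lborel)"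
    by (simp add: nn_integral_cmult ennreal_mult)
  also have "\<dots> \<le> (\<integral>\<^sup>+x. ennreal (slice_weight L Y) * cut_singularity (x - Y$1) * 6 \<partial>lborel)"
    by (intro nn_integral_mono mult_left_mono sing6) auto
  also have "\<dots> = ennreal (slice_weight L Y) * (\<integral>\<^sup>+x. cut_singularity (x - Y$1) \<partial>lborel) * 6"
    by (simp add: nn_integral_multc nn_integral_cmult)
  also have "\<dots> \<le> ennreal (slice_weight L Y) * 6 * 6"
    by (intro mult_right_mono mult_left_mono sing6) auto
  also have "\<dots> = ennreal (36 * slice_weight L Y)"
    by (simp add: ennreal_mult mult.assoc) (simp add: mult.commute)
  finally show ?thesis .
qed

text \<open>
  The rotation about the z axis by the angle arctan s.  Parametrizing by the tangent makes the second
  coordinate of the rotated point an affine function of s, up to the bounded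
  factor sqrt (1 + s^2).
\<close>

definition axis_rotation :: "real \<Rightarrow> real^3 \<Rightarrow> real^3" where
  "axis_rotation s Y = vector [(Y$1 - s * Y$2) / sqrt (1 + s\<^sup>2), (s * Y$1 + Y$2) / sqrt (1 + s\<^sup>2), Y$3]"

lemma axis_rotation_nth [simp]:
  "axis_rotation s Y $ 1 = (Y$1 - s * Y$2) / sqrt (1 + s\<^sup>2)"
  "axis_rotation s Y $ 2 = (s * Y$1 + Y$2) / sqrt (1 + s\<^sup>2)"
  "axis_rotation s Y $ 3 = Y$3"
  by (simp_all add: axis_rotation_def)

lemma axis_rotation_measurable [measurable (raw)]:
  assumes [measurable]: "f \<in> borel_measurable M" "g \<in> borel_measurable M"
  shows "(\<lambda>y. axis_rotation (f y) (g y)) \<in> borel_measurable M"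
proof -
  have "axis_rotation s Y = ((Y$1 - s * Y$2) / sqrt (1 + s\<^sup>2)) *\<^sub>R axis 1 1
      + ((s * Y$1 + Y$2) / sqrt (1 + s\<^sup>2)) *\<^sub>R axis 2 1 + Y$3 *\<^sub>R axis 3 1" for s Y
    by (simp add: vec_eq_iff forall_3 axis_def)
  then show ?thesis by simp
qed

lemma axis_rotation_sum_squares:
  "(axis_rotation s Y $ 1)\<^sup>2 + (axis_rotation s Y $ 2)\<^sup>2 = (Y$1)\<^sup>2 + (Y$2)\<^sup>2"
proof -
  have pos: "1 + s\<^sup>2 > 0" by (simp add: add_pos_nonneg)
  have "(axis_rotation s Y $ 1)\<^sup>2 + (axis_rotation s Y $ 2)\<^sup>2
      = ((Y$1 - s * Y$2)\<^sup>2 + (s * Y$1 + Y$2)\<^sup>2) / (1 + s\<^sup>2)"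
    using pos by (simp add: power_divide) (simp only: add_divide_distrib)
  also have "(Y$1 - s * Y$2)\<^sup>2 + (s * Y$1 + Y$2)\<^sup>2 = ((Y$1)\<^sup>2 + (Y$2)\<^sup>2) * (1 + s\<^sup>2)"
    by algebra
  finally show ?thesis using pos by simp
qed

lemma cyl_r_axis_rotation [simp]: "cyl_r (axis_rotation s Y) = cyl_r Y"
  unfolding cyl_r_def axis_rotation_sum_squares ..

lemma orthogonal_axis_rotation: "orthogonal_transformation (axis_rotation s)"
proof -
  have "linear (axis_rotation s)"
    by (rule linearI) (simp_all add: vec_eq_iff forall_3 add_divide_distrib diff_divide_distrib algebra_simps)
  moreover have "norm (axis_rotation s Y) = norm Y" for Y
    unfolding norm_vec3 axis_rotation_sum_squares by simp
  ultimately show ?thesis by (simp add: orthogonal_transformation)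
qed

text \<open>
  The integral of G h equals that of G (h o rotation) for every s; averaging the latter over
  s in [0, 1] and exchanging the integrals replaces h by its average.
\<close>

lemma nn_integral_average_rotations:
  assumes [measurable]: "G \<in> borel_measurable borel" "h \<in> borel_measurable borel"
    and G: "\<And>s Y. G (axis_rotation s Y) = G Y"
  shows "(\<integral>\<^sup>+Y. G Y * h Y \<partial>lborel)
       = (\<integral>\<^sup>+Y. G Y * (\<integral>\<^sup>+s. h (axis_rotation s Y) * indicator {0..1} s \<partial>lborel) \<partial>lborel)"
proof -
  have "(\<integral>\<^sup>+Y. G Y * (\<integral>\<^sup>+s. h (axis_rotation s Y) * indicator {0..1} s \<partial>lborel) \<partial>lborel)
      = (\<integral>\<^sup>+Y. \<integral>\<^sup>+s. G Y * h (axis_rotation s Y) * indicator {0..1} s \<partial>lborel \<partial>lborel)"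
    by (simp add: nn_integral_cmult[symmetric] mult.assoc)
  also have "\<dots> = (\<integral>\<^sup>+s. \<integral>\<^sup>+Y. G Y * h (axis_rotation s Y) * indicator {0..1} s \<partial>lborel \<partial>lborel)"
    by (rule lborel_pair.Fubini') measurable
  also have "\<dots> = (\<integral>\<^sup>+(s::real). (\<integral>\<^sup>+Y. G Y * h Y \<partial>lborel) * indicator {0..1} s \<partial>lborel)"
  proof (rule nn_integral_cong)
    fix s :: real
    have "(\<integral>\<^sup>+Y. G Y * h (axis_rotation s Y) * indicator {0..1} s \<partial>lborel)
        = (\<integral>\<^sup>+Y. (G (axis_rotation s Y) * h (axis_rotation s Y)) \<partial>lborel) * indicator {0..1} s"
      by (simp add: nn_integral_multc G)
    also have "\<dots> = (\<integral>\<^sup>+Y. G Y * h Y \<partial>lborel) * indicator {0..1} s"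
      by (subst nn_integral_lborel_orthogonal[OF orthogonal_axis_rotation, of "\<lambda>Y. G Y * h Y"]) auto
    finally show "(\<integral>\<^sup>+Y. G Y * h (axis_rotation s Y) * indicator {0..1} s \<partial>lborel)
        = (\<integral>\<^sup>+Y. G Y * h Y \<partial>lborel) * indicator {0..1} s" .
  qed
  also have "\<dots> = (\<integral>\<^sup>+Y. G Y * h Y \<partial>lborel)"
    by (simp add: nn_integral_cmult)
  finally show ?thesis ..
qed

text \<open>
  If |Y_2| \<le> 2 |Y_1|, the rotated second coordinate is Y_1 (s + Y_2/Y_1) / sqrt (1 + s^2), with |Y_1|
  comparable to r, so its singularity in s is integrable.  Otherwise |s Y_1 + Y_2| \<ge> |Y_2| / 2,
  which is comparable to r, and there is no singularity.
\<close>

lemma powr_axis_rotation_le: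
  assumes s: "0 \<le> s" "s \<le> 1" and r: "0 < cyl_r Y"
  shows "\<bar>axis_rotation s Y $ 2\<bar> powr (-2/3) \<le> 4 * cyl_r Y powr (-2/3) * (cut_singularity (s + Y$2 / Y$1) + 1)"
proof -
  let ?r = "cyl_r Y"
  let ?q = "sqrt (1 + s\<^sup>2)"
  have r2: "?r\<^sup>2 = (Y$1)\<^sup>2 + (Y$2)\<^sup>2" by (simp add: cyl_r_def)
  have "s\<^sup>2 \<le> 1" using s by (simp add: power_le_one)
  then have q: "0 < ?q" "?q\<^sup>2 \<le> 2" by (auto simp: add_pos_nonneg)
  have c8: "(?r / 8) powr (-2/3) = 4 * ?r powr (-2/3)"
  proof -
    have "(8::real) powr (2/3) = (2 powr 3) powr (2/3)" by (simp add: powr_numeral)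
    also have "\<dots> = 4" by (simp only: powr_powr) (simp add: powr_numeral)
    finally have "(8::real) powr (2/3) = 4" .
    then show ?thesis using r by (simp add: powr_divide powr_minus field_simps)
  qed
  \<comment> \<open>as 1 + s^2 \<le> 2, the assumption gives r sqrt (1 + s^2) \<le> sqrt 40 m \<le> 8 m\<close>
  have eighth: "(m / ?q) powr (-2/3) \<le> 4 * ?r powr (-2/3)" if m: "0 \<le> m" "?r\<^sup>2 \<le> 20 * m\<^sup>2" for m
  proof -
    have "(?r * ?q)\<^sup>2 = ?r\<^sup>2 * ?q\<^sup>2" by (simp add: power_mult_distrib)
    also have "\<dots> \<le> (20 * m\<^sup>2) * 2" using m q by (intro mult_mono) auto
    also have "\<dots> \<le> (8 * m)\<^sup>2" by (simp add: power_mult_distrib)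
    finally have "?r * ?q \<le> 8 * m" by (rule power2_le_imp_le) (use m in simp)
    then have "?r / 8 \<le> m / ?q" using q by (simp add: field_simps)
    then show ?thesis unfolding c8[symmetric] using r by (intro powr_mono2') auto
  qed
  show ?thesis
  proof (cases "(Y$2)\<^sup>2 \<le> 4 * (Y$1)\<^sup>2")
    case True
    then have y1: "Y$1 \<noteq> 0" using r r2 by auto
    have "\<bar>axis_rotation s Y $ 2\<bar> = (\<bar>Y$1\<bar> / ?q) * \<bar>s + Y$2 / Y$1\<bar>"
      using y1 q by (simp add: abs_mult[symmetric] abs_divide distrib_left mult.commute)
    then have "\<bar>axis_rotation s Y $ 2\<bar> powr (-2/3) = (\<bar>Y$1\<bar> / ?q) powr (-2/3) * \<bar>s + Y$2 / Y$1\<bar> powr (-2/3)"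
      using q by (simp only: powr_mult)
    also have "\<dots> \<le> (4 * ?r powr (-2/3)) * (cut_singularity (s + Y$2 / Y$1) + 1)"
    proof (intro mult_mono eighth)
      show "?r\<^sup>2 \<le> 20 * \<bar>Y$1\<bar>\<^sup>2" unfolding power2_abs r2 using True zero_le_power2[of "Y$1"] by linarith
      show "\<bar>s + Y$2 / Y$1\<bar> powr (-2/3) \<le> cut_singularity (s + Y$2 / Y$1) + 1"
      proof (cases "\<bar>s + Y$2 / Y$1\<bar> < 1")
        case False
        then have "\<bar>s + Y$2 / Y$1\<bar> powr (-2/3) \<le> 1 powr (-2/3)" by (intro powr_mono2') auto
        then show ?thesis by (simp add: add_increasing)
      qed (simp add: cut_singularity_def)
    qed auto
    finally show ?thesis .
  next
    case False
    have "2 * \<bar>Y$1\<bar> \<le> \<bar>Y$2\<bar>"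
      by (rule power2_le_imp_le) (use False in \<open>auto simp: power_mult_distrib\<close>)
    moreover have "\<bar>s * Y$1\<bar> \<le> \<bar>Y$1\<bar>" using s by (simp add: abs_mult mult_left_le_one_le)
    moreover have "\<bar>Y$2\<bar> \<le> \<bar>s * Y$1 + Y$2\<bar> + \<bar>s * Y$1\<bar>"
      using abs_triangle_ineq4[of "s * Y$1 + Y$2" "s * Y$1"] by simp
    moreover have "a \<le> 2 * m" if "2 * b \<le> a" "c \<le> b" "a \<le> m + c" for a b c m :: real
      using that by linarith
    ultimately have "\<bar>Y$2\<bar> \<le> 2 * \<bar>s * Y$1 + Y$2\<bar>" by blast
    then have "\<bar>Y$2\<bar>\<^sup>2 \<le> (2 * \<bar>s * Y$1 + Y$2\<bar>)\<^sup>2" by (intro power_mono) auto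
    then have "(Y$2)\<^sup>2 \<le> 4 * \<bar>s * Y$1 + Y$2\<bar>\<^sup>2" by (simp add: power_mult_distrib)
    then have "?r\<^sup>2 \<le> 20 * \<bar>s * Y$1 + Y$2\<bar>\<^sup>2" using False r2 zero_le_power2[of "Y$2"] by linarith
    then have "\<bar>axis_rotation s Y $ 2\<bar> powr (-2/3) \<le> 4 * ?r powr (-2/3)"
      using eighth[of "\<bar>s * Y$1 + Y$2\<bar>"] q by (simp add: abs_divide)
    also have "\<dots> \<le> 4 * ?r powr (-2/3) * (cut_singularity (s + Y$2 / Y$1) + 1)"
      by (simp add: algebra_simps)
    finally show ?thesis .
  qed
qed

text \<open>
  The average of |Y_2|^(-2/3) is of order r^(-2/3), and multiplying by r leaves
  r^(1/3) \<le> L^(1/3) \<le> L.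
\<close>

lemma average_slice_weight_le:
  assumes "1 \<le> L"
  shows "(\<integral>\<^sup>+s. ennreal (slice_weight L (axis_rotation s Y)) * indicator {0..1} s \<partial>lborel) \<le> ennreal (28 * L)"
proof (cases "0 < cyl_r Y \<and> cyl_r Y \<le> L")
  case False
  then have "cyl_r Y = 0 \<or> L < cyl_r Y" using cyl_r_nonneg[of Y] by linarith
  then have "slice_weight L (axis_rotation s Y) = 0" for s
    by (auto simp: slice_weight_def)
  then show ?thesis by simp
next
  case True
  let ?r = "cyl_r Y"
  have rL: "4 * ?r powr (-2/3) * ?r \<le> 4 * L"
  proof -
    have "?r powr (-2/3) * ?r = ?r powr (1/3)"
      using True powr_add[of ?r "-2/3" 1] by simp
    also have "\<dots> \<le> L powr (1/3)" using True by (intro powr_mono2) auto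
    also have "\<dots> \<le> L powr 1" using assms by (intro powr_mono) auto
    finally show ?thesis using assms by simp
  qed
  have "(\<integral>\<^sup>+s. ennreal (slice_weight L (axis_rotation s Y)) * indicator {0..1} s \<partial>lborel)
     \<le> (\<integral>\<^sup>+s. ennreal (4 * L) * (ennreal (cut_singularity (Y$2 / Y$1 + 1 * s)) + indicator {0..1} s) \<partial>lborel)"
  proof (rule nn_integral_mono)
    fix s :: real
    show "ennreal (slice_weight L (axis_rotation s Y)) * indicator {0..1} s
        \<le> ennreal (4 * L) * (ennreal (cut_singularity (Y$2 / Y$1 + 1 * s)) + indicator {0..1} s)"
    proof (cases "s \<in> {0..1}")
      case s: True
      have "slice_weight L (axis_rotation s Y) = ?r * \<bar>axis_rotation s Y $ 2\<bar> powr (-2/3)"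
        using True by (simp add: slice_weight_def)
      also have "\<dots> \<le> ?r * (4 * ?r powr (-2/3) * (cut_singularity (s + Y$2 / Y$1) + 1))"
        using s True by (intro mult_left_mono powr_axis_rotation_le) auto
      also have "\<dots> = (4 * ?r powr (-2/3) * ?r) * (cut_singularity (s + Y$2 / Y$1) + 1)" by simp
      also have "\<dots> \<le> (4 * L) * (cut_singularity (s + Y$2 / Y$1) + 1)"
        by (intro mult_right_mono rL) auto
      finally have "slice_weight L (axis_rotation s Y) \<le> (4 * L) * (cut_singularity (Y$2 / Y$1 + s) + 1)"
        by (simp add: add.commute)
      then have "ennreal (slice_weight L (axis_rotation s Y)) \<le> ennreal ((4 * L) * (cut_singularity (Y$2 / Y$1 + s) + 1))"
        by (rule ennreal_leI)
      then show ?thesis using s assms by (simp add: ennreal_mult)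
    qed simp
  qed
  also have "\<dots> = ennreal (4 * L) * ((\<integral>\<^sup>+s. cut_singularity (Y$2 / Y$1 + 1 * s) \<partial>lborel) + 1)"
    by (simp add: nn_integral_cmult nn_integral_add)
  also have "\<dots> \<le> ennreal (4 * L) * ennreal 7"
    using nn_integral_cut_singularity_affine[of 1 "Y$2 / Y$1"]
    by (intro mult_left_mono) (auto dest: add_right_mono[where c = 1])
  also have "\<dots> = ennreal (28 * L)"
    using assms by (simp flip: ennreal_mult ennreal_numeral)
  finally show ?thesis .
qed

text \<open>
  Second half of the Schur test, applied with G = g^p.  The measure dx dz has no factor r, so it is
  larger than three-dimensional measure near the axis; the factor r(Y) in the kernel
  compensates for this.
\<close>

lemma plane_integral_near_kernel_le:
  assumes G[measurable]: "G \<in> borel_measurable borel" and nonneg: "\<And>Y. 0 \<le> G Y"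
    and rot: "\<And>s Y. G (axis_rotation s Y) = G Y" and L: "1 \<le> L"
  shows "(\<integral>\<^sup>+x. \<integral>\<^sup>+z. \<integral>\<^sup>+Y. ennreal (G Y * near_kernel L (slice_pt x z) Y) \<partial>lborel \<partial>lborel \<partial>lborel)
     \<le> ennreal (1008 * L) * (\<integral>\<^sup>+Y. G Y \<partial>lborel)"
proof -
  have "(\<integral>\<^sup>+x. \<integral>\<^sup>+z. \<integral>\<^sup>+Y. ennreal (G Y * near_kernel L (slice_pt x z) Y) \<partial>lborel \<partial>lborel \<partial>lborel)
     = (\<integral>\<^sup>+x. \<integral>\<^sup>+Y. \<integral>\<^sup>+z. ennreal (G Y * near_kernel L (slice_pt x z) Y) \<partial>lborel \<partial>lborel \<partial>lborel)"
    by (intro nn_integral_cong lborel_pair.Fubini') measurable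
  also have "\<dots> = (\<integral>\<^sup>+Y. \<integral>\<^sup>+x. \<integral>\<^sup>+z. ennreal (G Y * near_kernel L (slice_pt x z) Y) \<partial>lborel \<partial>lborel \<partial>lborel)"
    by (intro lborel_pair.Fubini') measurable
  also have "\<dots> = (\<integral>\<^sup>+Y. ennreal (G Y) * (\<integral>\<^sup>+x. \<integral>\<^sup>+z. near_kernel L (slice_pt x z) Y \<partial>lborel \<partial>lborel) \<partial>lborel)"
    by (simp add: ennreal_mult nonneg nn_integral_cmult)
  also have "\<dots> \<le> (\<integral>\<^sup>+Y. ennreal (G Y) * ennreal (36 * slice_weight L Y) \<partial>lborel)"
    \<comment> \<open>the slice bound fails on the plane of the slices itself, where Y_2 = 0\<close>
    using AE_lborel_component_neq[of 2 0]
    by (intro nn_integral_mono_AE; eventually_elim) (intro mult_left_mono nn_integral_near_kernel_slice_le; simp)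
  also have "\<dots> = 36 * (\<integral>\<^sup>+Y. ennreal (G Y) * ennreal (slice_weight L Y) \<partial>lborel)"
    by (simp add: nn_integral_cmult[symmetric] ennreal_mult mult.left_commute)
  also have "\<dots> = 36 * (\<integral>\<^sup>+Y. ennreal (G Y) * (\<integral>\<^sup>+s. ennreal (slice_weight L (axis_rotation s Y)) * indicator {0..1} s \<partial>lborel) \<partial>lborel)"
    by (subst nn_integral_average_rotations) (auto simp: rot)
  also have "\<dots> \<le> 36 * (\<integral>\<^sup>+Y. ennreal (G Y) * ennreal (28 * L) \<partial>lborel)"
    by (intro mult_left_mono nn_integral_mono average_slice_weight_le L) auto
  also have "\<dots> = ennreal (1008 * L) * (\<integral>\<^sup>+Y. G Y \<partial>lborel)"
  proof -
    have "36 * ennreal (28 * L) = ennreal (1008 * L)"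
      using L by (simp flip: ennreal_mult ennreal_numeral)
    then show ?thesis by (simp add: nn_integral_multc mult.left_commute mult.commute)
  qed
  finally show ?thesis .
qed

section \<open>Difference quotients of the Newtonian potential\<close>

text \<open>
  From 1/a - 1/b = (b - a) / (a b), the triangle inequality, and 1/(a b) \<le> 1/a^2 + 1/b^2.  The last step
  separates X from X', so that each is handled by an integral of the same kind.
\<close>

lemma inverse_norm_diff_le:
  fixes X X' Y :: "'a::real_normed_vector"
  assumes "Y \<noteq> X" "Y \<noteq> X'"
  shows "\<bar>1 / norm (X - Y) - 1 / norm (X' - Y)\<bar>
     \<le> norm (X - X') * (1 / (norm (X - Y))\<^sup>2 + 1 / (norm (X' - Y))\<^sup>2)"
proof -
  define a b where "a = norm (X - Y)" and "b = norm (X' - Y)"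
  have pos: "a > 0" "b > 0" using assms by (auto simp: a_def b_def)
  have diff: "\<bar>b - a\<bar> \<le> norm (X - X')"
    using norm_triangle_ineq3[of "X' - Y" "X - Y"] by (simp add: a_def b_def norm_minus_commute)
  have "1 / a - 1 / b = (b - a) * (1 / a * (1 / b))"
    using pos by (simp add: field_simps)
  then have "\<bar>1 / a - 1 / b\<bar> = \<bar>b - a\<bar> * (1 / a * (1 / b))"
    using pos by (simp add: abs_mult)
  also have "\<dots> \<le> norm (X - X') * ((1 / a)\<^sup>2 + (1 / b)\<^sup>2)"
  proof (intro mult_mono diff)
    have "2 * (1 / a * (1 / b)) \<le> (1 / a)\<^sup>2 + (1 / b)\<^sup>2"
      using sum_squares_bound[of "1 / a" "1 / b"] by simp
    moreover have "0 \<le> 1 / a * (1 / b)" using pos by simp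
    ultimately show "1 / a * (1 / b) \<le> (1 / a)\<^sup>2 + (1 / b)\<^sup>2" by linarith
  qed (use pos in auto)
  finally show ?thesis by (simp add: a_def b_def power_divide)
qed

lemma norm_e_theta: "norm (e_theta Y) = (if cyl_r Y = 0 then 0 else 1)"
proof (cases "cyl_r Y = 0")
  case False
  then have pos: "cyl_r Y > 0" using cyl_r_nonneg[of Y] by linarith
  have "(norm (e_theta Y))\<^sup>2 = ((Y$1)\<^sup>2 + (Y$2)\<^sup>2) / (cyl_r Y)\<^sup>2"
    by (simp add: norm_vec3 e_theta_def power_divide add_divide_distrib)
  also have "(Y$1)\<^sup>2 + (Y$2)\<^sup>2 = (cyl_r Y)\<^sup>2" by (simp add: cyl_r_def)
  finally have "(norm (e_theta Y))\<^sup>2 = 1" using pos by simp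
  then show ?thesis using False norm_ge_zero[of "e_theta Y"] by (auto simp: power2_eq_1_iff)
qed (simp add: e_theta_def norm_vec3)

lemma norm_azimuthal_field:
  "norm (azimuthal_field w Y) = cyl_r Y * \<bar>w (cyl_r Y) (cyl_z Y) / cyl_r Y\<bar>"
  by (simp add: azimuthal_field_def norm_e_theta)

definition newtonian_integrand :: "(real \<Rightarrow> real \<Rightarrow> real) \<Rightarrow> real^3 \<Rightarrow> real^3 \<Rightarrow> real^3" where
  "newtonian_integrand w X Y = (1 / (4 * pi * norm (X - Y))) *\<^sub>R azimuthal_field w Y"

text \<open>
  The profile w is an arbitrary function of (r, z).  Measurability of w / r is recovered from that of
  the integrand of the potential at X = 0 by multiplying the kernel away; at Y = 0 both sides
  vanish because e_theta does.
\<close>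

lemma vorticity_ratio_measurable:
  assumes "integrable lborel (newtonian_integrand w 0)"
  shows "(\<lambda>Y. \<bar>w (cyl_r Y) (cyl_z Y) / cyl_r Y\<bar>) \<in> borel_measurable borel"
proof -
  have [measurable]: "newtonian_integrand w 0 \<in> borel_measurable borel"
    using borel_measurable_integrable[OF assms] by simp
  have "azimuthal_field w Y = (4 * pi * norm Y) *\<^sub>R newtonian_integrand w 0 Y" for Y
  proof (cases "Y = 0")
    case True
    then have "cyl_r Y = 0" by (simp add: cyl_r_def)
    then show ?thesis using True by (simp add: azimuthal_field_def e_theta_def vec_eq_iff forall_3)
  qed (simp add: newtonian_integrand_def)
  then have eq: "\<bar>w (cyl_r Y) (cyl_z Y) / cyl_r Y\<bar>
      = norm ((4 * pi * norm Y) *\<^sub>R newtonian_integrand w 0 Y) / cyl_r Y" for Y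
    using norm_azimuthal_field[of w Y] by (cases "cyl_r Y = 0") simp_all
  show ?thesis unfolding eq by measurable
qed

text \<open>
  The integrands at X and X' are subtracted before norms are taken; the kernel difference gains the
  factor |X - X'|, and r(Y) / |X - Y|^2 is then split into its near part and a part bounded by L.
\<close>

lemma newtonian_difference_quotient_le:
  fixes w :: "real \<Rightarrow> real \<Rightarrow> real"
  defines "g \<equiv> \<lambda>Y. \<bar>w (cyl_r Y) (cyl_z Y) / cyl_r Y\<bar>"
  assumes int: "\<And>X. integrable lborel (newtonian_integrand w X)"
    and A: "\<And>X. A X = (\<integral>Y. newtonian_integrand w X Y \<partial>lborel)"
    and L: "2 \<le> L" "cyl_r X \<le> L - 2" "cyl_r X' \<le> L - 2" and neq: "X \<noteq> X'"
  shows "ennreal (norm (A X - A X') / norm (X - X'))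
     \<le> (\<integral>\<^sup>+Y. ennreal (g Y * (near_kernel L X Y + near_kernel L X' Y)) \<partial>lborel) + ennreal (2 * L) * (\<integral>\<^sup>+Y. ennreal (g Y) \<partial>lborel)"
proof -
  have [measurable]: "g \<in> borel_measurable borel"
    unfolding g_def by (rule vorticity_ratio_measurable[OF int])
  have g0: "0 \<le> g Y" for Y by (simp add: g_def)
  let ?d = "norm (X - X')"
  have d: "0 < ?d" using neq by simp
  have pointwise: "norm (newtonian_integrand w X Y - newtonian_integrand w X' Y)
      \<le> ?d * (g Y * (near_kernel L X Y + near_kernel L X' Y) + 2 * L * g Y)" if "Y \<noteq> X" "Y \<noteq> X'" for Y
  proof -
    let ?k = "1 / norm (X - Y) - 1 / norm (X' - Y)"
    let ?K = "1 / (norm (X - Y))\<^sup>2 + 1 / (norm (X' - Y))\<^sup>2"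
    have "newtonian_integrand w X Y - newtonian_integrand w X' Y = (1 / (4 * pi) * ?k) *\<^sub>R azimuthal_field w Y"
      by (simp add: newtonian_integrand_def scaleR_left_diff_distrib right_diff_distrib)
    then have "norm (newtonian_integrand w X Y - newtonian_integrand w X' Y)
        = 1 / (4 * pi) * (\<bar>?k\<bar> * norm (azimuthal_field w Y))" by (simp add: abs_mult)
    also have "\<dots> \<le> 1 * (\<bar>?k\<bar> * norm (azimuthal_field w Y))"
      using pi_gt3 by (intro mult_right_mono) auto
    also have "\<dots> \<le> (?d * ?K) * norm (azimuthal_field w Y)"
      using inverse_norm_diff_le[OF that] by (simp add: mult_right_mono)
    also have "\<dots> = ?d * (g Y * (cyl_r Y / (norm (X - Y))\<^sup>2 + cyl_r Y / (norm (X' - Y))\<^sup>2))"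
    proof -
      have "norm (azimuthal_field w Y) = cyl_r Y * g Y" by (simp only: norm_azimuthal_field g_def)
      then show ?thesis by (simp add: algebra_simps)
    qed
    also have "\<dots> \<le> ?d * (g Y * ((near_kernel L X Y + L) + (near_kernel L X' Y + L)))"
      using L by (intro mult_left_mono add_mono Biot_Savart_kernel_le_near_kernel g0) auto
    also have "\<dots> = ?d * (g Y * (near_kernel L X Y + near_kernel L X' Y) + 2 * L * g Y)"
      by (simp add: algebra_simps)
    finally show ?thesis .
  qed
  have "A X - A X' = (\<integral>Y. newtonian_integrand w X Y - newtonian_integrand w X' Y \<partial>lborel)"
    unfolding A using int by simp
  then have "ennreal (norm (A X - A X'))
      \<le> (\<integral>\<^sup>+Y. norm (newtonian_integrand w X Y - newtonian_integrand w X' Y) \<partial>lborel)"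
    using int by (simp only:) (intro integral_norm_bound_ennreal, simp)
  also have "\<dots> \<le> (\<integral>\<^sup>+Y. ennreal ?d * (ennreal (g Y * (near_kernel L X Y + near_kernel L X' Y)) + ennreal (2 * L) * ennreal (g Y)) \<partial>lborel)"
  proof (rule nn_integral_mono_AE, use AE_lborel_singleton[of X] AE_lborel_singleton[of X'] in eventually_elim)
    case (elim Y)
    have "ennreal ?d * (ennreal (g Y * (near_kernel L X Y + near_kernel L X' Y)) + ennreal (2 * L) * ennreal (g Y))
        = ennreal (?d * (g Y * (near_kernel L X Y + near_kernel L X' Y) + 2 * L * g Y))"
      using L g0 by (simp add: ennreal_mult ennreal_plus)
    then show ?case using pointwise[OF elim] by (simp add: ennreal_leI)
  qed
  also have "\<dots> = ennreal ?d * ((\<integral>\<^sup>+Y. ennreal (g Y * (near_kernel L X Y + near_kernel L X' Y)) \<partial>lborel)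
      + ennreal (2 * L) * (\<integral>\<^sup>+Y. ennreal (g Y) \<partial>lborel))"
    by (simp add: nn_integral_cmult nn_integral_add)
  finally have "ennreal (1 / ?d) * ennreal (norm (A X - A X'))
     \<le> ennreal (1 / ?d) * (ennreal ?d * ((\<integral>\<^sup>+Y. ennreal (g Y * (near_kernel L X Y + near_kernel L X' Y)) \<partial>lborel)
      + ennreal (2 * L) * (\<integral>\<^sup>+Y. ennreal (g Y) \<partial>lborel)))"
    by (rule mult_left_mono) simp
  then show ?thesis
    using d by (simp add: mult.assoc[symmetric] flip: ennreal_mult)
qed

section \<open>Lp estimate of a difference quotient on the half plane\<close>

text \<open>
  The end point X' of a quotient is a translate or a reflection of X within the plane, so the integral
  of the near kernel at X' over the plane is the one at X.
\<close>

lemma nn_integral_plane_affine: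
  fixes H :: "real \<Rightarrow> real \<Rightarrow> ennreal"
  assumes [measurable]: "(\<lambda>(x, z). H x z) \<in> borel_measurable (borel \<Otimes>\<^sub>M borel)" and c: "\<bar>c\<bar> = 1"
  shows "(\<integral>\<^sup>+x. \<integral>\<^sup>+z. H (c * x + a) (z + b) \<partial>lborel \<partial>lborel) = (\<integral>\<^sup>+x. \<integral>\<^sup>+z. H x z \<partial>lborel \<partial>lborel)"
proof -
  have "(\<integral>\<^sup>+z. H x (z + b) \<partial>lborel) = (\<integral>\<^sup>+z. H x z \<partial>lborel)" for x
    using nn_integral_real_affine[of "H x" 1 b] by (simp add: add.commute)
  moreover have "(\<integral>\<^sup>+x. \<integral>\<^sup>+z. H (c * x + a) z \<partial>lborel \<partial>lborel) = (\<integral>\<^sup>+x. \<integral>\<^sup>+z. H x z \<partial>lborel \<partial>lborel)"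
    using nn_integral_real_affine[of "\<lambda>x. \<integral>\<^sup>+z. H x z \<partial>lborel" c a] c by (auto simp: add.commute)
  ultimately show ?thesis by simp
qed

lemma powr_le_two_powr_max_diff:
  fixes q f p :: real
  assumes "0 \<le> q" "0 \<le> f" "0 < p"
  shows "q powr p \<le> 2 powr p * (f powr p + (max 0 (q - f)) powr p)"
proof -
  have "q powr p \<le> (2 * max f (max 0 (q - f))) powr p"
    using assms by (intro powr_mono2) (auto simp: max_def)
  also have "\<dots> = 2 powr p * (max f (max 0 (q - f))) powr p" by (rule powr_mult)
  also have "\<dots> \<le> 2 powr p * (f powr p + (max 0 (q - f)) powr p)"
    by (intro mult_left_mono) (auto simp: max_def)
  finally show ?thesis .
qed

text \<open>
  The bounded part of the kernel contributes the L^1 norm F of g on a set of measure 2 R^2, and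
  the near part contributes the L^p norm by the Schur test.  All numerical constants are absorbed
  into a p-th power, which uses p \<ge> 1.  The parameters a, b, c cover the shifts in r and in z and
  the reflection r \<mapsto> -r at once, with a bound that does not depend on a and b.
\<close>

lemma slice_Lp_estimate:
  fixes g :: "real^3 \<Rightarrow> real" and q :: "real \<Rightarrow> real \<Rightarrow> real"
  assumes R: "0 < R" "L = R + 3" and p: "1 < p" and c: "\<bar>c\<bar> = 1"
    and g[measurable]: "g \<in> borel_measurable borel" and nonneg: "\<And>Y. 0 \<le> g Y"
    and rot: "\<And>s Y. g (axis_rotation s Y) = g Y"
    and F: "(\<integral>\<^sup>+Y. g Y \<partial>lborel) = ennreal F" "0 \<le> F"
    and q0: "\<And>x z. 0 \<le> q x z"
    and q: "\<And>x z. x \<in> {0<..R} \<Longrightarrow> z \<in> {-R..R} \<Longrightarrow>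
      ennreal (q x z) \<le> (\<integral>\<^sup>+Y. ennreal (g Y * (near_kernel L (slice_pt x z) Y + near_kernel L (slice_pt (c * x + a) (z + b)) Y)) \<partial>lborel)
         + ennreal (2 * L) * (\<integral>\<^sup>+Y. ennreal (g Y) \<partial>lborel)"
  shows "(\<integral>\<^sup>+x. \<integral>\<^sup>+z. ennreal (q x z powr p) * indicator ({0<..R} \<times> {-R..R}) (x, z) \<partial>lborel \<partial>lborel)
     \<le> ennreal ((4608 * L ^ 3) powr p) * (ennreal (F powr p) + (\<integral>\<^sup>+Y. ennreal (g Y powr p) \<partial>lborel))"
proof -
  let ?S = "{0<..R} \<times> {-R..R}"
  define H where "H x z = (\<integral>\<^sup>+Y. ennreal (g Y powr p * near_kernel L (slice_pt x z) Y) \<partial>lborel)" for x z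
  have [measurable]: "(\<lambda>(x, z). H x z) \<in> borel_measurable (borel \<Otimes>\<^sub>M borel)"
    unfolding H_def by measurable
  let ?P = "\<integral>\<^sup>+Y. ennreal (g Y powr p) \<partial>lborel"
  let ?f = "2 * L * F"
  let ?c1 = "2 powr p * ?f powr p" and ?c2 = "2 powr p * (432 * L) powr (p - 1)"
  have L: "3 \<le> L" using R by simp
  have pointwise: "ennreal (q x z powr p) \<le> ennreal ?c1 + ennreal ?c2 * (H x z + H (c * x + a) (z + b))"
    if xz: "x \<in> {0<..R}" "z \<in> {-R..R}" for x z
  proof -
    let ?X = "slice_pt x z" and ?X' = "slice_pt (c * x + a) (z + b)"
    have "ennreal (q x z) \<le> (\<integral>\<^sup>+Y. ennreal (g Y * (near_kernel L ?X Y + near_kernel L ?X' Y)) \<partial>lborel) + ennreal ?f"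
      using q[OF xz] F L by (simp add: ennreal_mult)
    then have d: "ennreal (max 0 (q x z - ?f)) \<le> (\<integral>\<^sup>+Y. ennreal (g Y * (near_kernel L ?X Y + near_kernel L ?X' Y)) \<partial>lborel)"
      using L F by (simp add: max_def ennreal_minus[symmetric] ennreal_minus_le_iff add.commute)
    have K: "(\<integral>\<^sup>+Y. ennreal (near_kernel L ?X Y + near_kernel L ?X' Y) \<partial>lborel) \<le> ennreal (432 * L)"
    proof -
      have "(\<integral>\<^sup>+Y. ennreal (near_kernel L ?X Y + near_kernel L ?X' Y) \<partial>lborel)
          = (\<integral>\<^sup>+Y. near_kernel L ?X Y \<partial>lborel) + (\<integral>\<^sup>+Y. near_kernel L ?X' Y \<partial>lborel)"
        by (simp add: nn_integral_add)
      also have "\<dots> \<le> ennreal (216 * L) + ennreal (216 * L)"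
        using L by (intro add_mono nn_integral_near_kernel_le) auto
      also have "\<dots> = ennreal (432 * L)" using L by (simp flip: ennreal_plus)
      finally show ?thesis .
    qed
    have "ennreal (q x z powr p) \<le> ennreal (2 powr p * (?f powr p + (max 0 (q x z - ?f)) powr p))"
      using q0 L F p by (intro ennreal_leI powr_le_two_powr_max_diff) auto
    also have "\<dots> = ennreal ?c1 + ennreal (2 powr p) * ennreal ((max 0 (q x z - ?f)) powr p)"
      by (simp add: ennreal_mult ennreal_plus distrib_left)
    also have "ennreal ((max 0 (q x z - ?f)) powr p)
        \<le> ennreal ((432 * L) powr (p - 1)) * (\<integral>\<^sup>+Y. ennreal (g Y powr p * (near_kernel L ?X Y + near_kernel L ?X' Y)) \<partial>lborel)"
      using K d L p nonneg by (intro nn_integral_powr_weighted_le) auto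
    also have "(\<integral>\<^sup>+Y. ennreal (g Y powr p * (near_kernel L ?X Y + near_kernel L ?X' Y)) \<partial>lborel) = H x z + H (c * x + a) (z + b)"
      by (simp add: H_def nn_integral_add distrib_left ennreal_plus)
    finally show ?thesis by (simp add: ennreal_mult mult.assoc mult_left_mono)
  qed
  have HP: "(\<integral>\<^sup>+x. \<integral>\<^sup>+z. H x z \<partial>lborel \<partial>lborel) \<le> ennreal (1008 * L) * ?P"
    unfolding H_def using rot L by (intro plane_integral_near_kernel_le) auto
  have "(\<integral>\<^sup>+x. \<integral>\<^sup>+z. ennreal (q x z powr p) * indicator ?S (x, z) \<partial>lborel \<partial>lborel)
     \<le> (\<integral>\<^sup>+x. \<integral>\<^sup>+z. ennreal ?c1 * (indicator {0<..R} x * indicator {-R..R} z)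
            + ennreal ?c2 * (H x z + H (c * x + a) (z + b)) \<partial>lborel \<partial>lborel)"
  proof (intro nn_integral_mono)
    fix x z :: real
    show "ennreal (q x z powr p) * indicator ?S (x, z) \<le> ennreal ?c1 * (indicator {0<..R} x * indicator {-R..R} z)
            + ennreal ?c2 * (H x z + H (c * x + a) (z + b))"
      using pointwise[of x z] by (cases "x \<in> {0<..R} \<and> z \<in> {-R..R}") auto
  qed
  also have "\<dots> = ennreal ?c1 * (\<integral>\<^sup>+x. indicator {0<..R} x * (\<integral>\<^sup>+z. indicator {-R..R} z \<partial>lborel) \<partial>lborel)
      + ennreal ?c2 * ((\<integral>\<^sup>+x. \<integral>\<^sup>+z. H x z \<partial>lborel \<partial>lborel)
        + (\<integral>\<^sup>+x. \<integral>\<^sup>+z. H (c * x + a) (z + b) \<partial>lborel \<partial>lborel))"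
    by (simp add: nn_integral_add nn_integral_cmult)
  also have "(\<integral>\<^sup>+x. \<integral>\<^sup>+z. H (c * x + a) (z + b) \<partial>lborel \<partial>lborel) = (\<integral>\<^sup>+x. \<integral>\<^sup>+z. H x z \<partial>lborel \<partial>lborel)"
    by (rule nn_integral_plane_affine) (use c in auto)
  also have "(\<integral>\<^sup>+x. indicator {0<..R} x * (\<integral>\<^sup>+z. indicator {-R..R} z \<partial>lborel) \<partial>lborel) = ennreal (2 * R\<^sup>2)"
    using R by (simp add: nn_integral_multc power2_eq_square flip: ennreal_mult)
  also have "ennreal ?c1 * ennreal (2 * R\<^sup>2) + ennreal ?c2 * ((\<integral>\<^sup>+x. \<integral>\<^sup>+z. H x z \<partial>lborel \<partial>lborel) + (\<integral>\<^sup>+x. \<integral>\<^sup>+z. H x z \<partial>lborel \<partial>lborel))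
      \<le> ennreal ?c1 * ennreal (2 * R\<^sup>2) + ennreal ?c2 * (ennreal (1008 * L) * ?P + ennreal (1008 * L) * ?P)"
    by (intro add_left_mono mult_left_mono add_mono HP) auto
  also have "\<dots> = ennreal (?c1 * (2 * R\<^sup>2)) + ennreal (?c2 * (2016 * L)) * ?P"
  proof -
    have "ennreal (1008 * L) * ?P + ennreal (1008 * L) * ?P = ennreal (2016 * L) * ?P"
      using L by (simp add: distrib_right[symmetric] flip: ennreal_plus)
    then show ?thesis using L by (simp add: ennreal_mult mult.assoc)
  qed
  also have "\<dots> \<le> ennreal ((4608 * L ^ 3) powr p * F powr p) + ennreal ((4608 * L ^ 3) powr p) * ?P"
  proof (intro add_mono mult_right_mono ennreal_leI)
    have L1: "1 \<le> L" "0 \<le> L" using L by auto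
    have L3: "L \<le> L ^ 3" using L by (intro self_le_power) auto
    have "2 * R\<^sup>2 \<le> 2 * L\<^sup>2" using R by (intro mult_left_mono power_mono) auto
    also have "\<dots> = (2 * L\<^sup>2) powr 1" using L by simp
    also have "\<dots> \<le> (2 * L\<^sup>2) powr p"
      using p one_le_power[OF L1(1), of 2] by (intro powr_mono) linarith+
    finally have "?c1 * (2 * R\<^sup>2) \<le> ?c1 * (2 * L\<^sup>2) powr p" by (intro mult_left_mono) auto
    also have "\<dots> = (2 * ?f * (2 * L\<^sup>2)) powr p" by (simp only: powr_mult)
    also have "\<dots> \<le> (4608 * L ^ 3 * F) powr p"
      using F L p by (intro powr_mono2) (auto simp: power2_eq_square power3_eq_cube mult_ac)
    finally show "?c1 * (2 * R\<^sup>2) \<le> (4608 * L ^ 3) powr p * F powr p" by (simp only: powr_mult)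
    have "?c2 * (2016 * L) \<le> 2 powr p * (2016 * L) powr (p - 1) * (2016 * L) powr 1"
      using L p by (intro mult_mono powr_mono2) auto
    also have "\<dots> = (2 * (2016 * L)) powr p"
      unfolding powr_mult[of 2 "2016 * L" p] mult.assoc powr_add[symmetric] by simp
    also have "\<dots> \<le> (4608 * L ^ 3) powr p"
      using L L3 p by (intro powr_mono2) auto
    finally show "?c2 * (2016 * L) \<le> (4608 * L ^ 3) powr p" .
  qed auto
  also have "\<dots> = ennreal ((4608 * L ^ 3) powr p) * (ennreal (F powr p) + ?P)"
    by (simp add: distrib_left ennreal_mult)
  finally show ?thesis .
qed

section \<open>The velocity as a limit of difference quotients\<close>

text \<open>
  The differential is sampled along the sequence of steps 1/(n+1), since Fatou's lemma asks for
  a sequence.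
\<close>

lemma difference_quotient_tendsto_frechet_derivative:
  fixes f :: "'a::real_normed_vector \<Rightarrow> 'b::real_normed_vector"
  assumes f: "f differentiable at X" and e: "norm e = 1"
  shows "(\<lambda>n. real (Suc n) *\<^sub>R (f (X + inverse (real (Suc n)) *\<^sub>R e) - f X)) \<longlonglongrightarrow> frechet_derivative f (at X) e"
proof -
  let ?D = "frechet_derivative f (at X)"
  let ?h = "\<lambda>n. inverse (real (Suc n)) *\<^sub>R e"
  have D: "(f has_derivative ?D) (at X)" using f frechet_derivative_works by blast
  have lin: "linear ?D" using linear_frechet_derivative[OF f] .
  have "?h \<longlonglongrightarrow> 0 *\<^sub>R e" by (intro tendsto_scaleR LIMSEQ_inverse_real_of_nat tendsto_const)
  then have "filterlim ?h (at 0) sequentially"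
    using e by (auto simp: filterlim_at)
  then have "(\<lambda>n. norm (f (X + ?h n) - f X - ?D (?h n)) / norm (?h n)) \<longlonglongrightarrow> 0"
    by (rule filterlim_compose[OF conjunct2[OF D[unfolded has_derivative_at]]])
  moreover have "norm (f (X + ?h n) - f X - ?D (?h n)) / norm (?h n)
      = norm (real (Suc n) *\<^sub>R (f (X + ?h n) - f X) - ?D e)" for n
  proof -
    have "real (Suc n) *\<^sub>R (f (X + ?h n) - f X) - ?D e = real (Suc n) *\<^sub>R (f (X + ?h n) - f X - ?D (?h n))"
      by (simp add: linear_cmul[OF lin] scaleR_diff_right del: of_nat_Suc)
    then show ?thesis using e by (simp add: divide_inverse mult.commute del: of_nat_Suc)
  qed
  ultimately have "(\<lambda>n. norm (real (Suc n) *\<^sub>R (f (X + ?h n) - f X) - ?D e)) \<longlonglongrightarrow> 0"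
    by simp
  from Lim_null[THEN iffD2, OF tendsto_norm_zero_cancel[OF this]] show ?thesis .
qed

lemma tendsto_slice_pt:
  assumes "(f \<longlongrightarrow> x) F" "(g \<longlongrightarrow> z) F"
  shows "((\<lambda>n. slice_pt (f n) (g n)) \<longlongrightarrow> slice_pt x z) F"
  unfolding slice_pt_eq by (intro tendsto_intros assms)

text \<open>
  The factor x / |x| is the sign of x: the azimuthal direction is reversed on the mirror image
  (-x, 0, z).
\<close>

lemma azimuthal_field_slice_pt: "azimuthal_field psi (slice_pt x z) = (psi \<bar>x\<bar> z * (x / \<bar>x\<bar>)) *\<^sub>R axis 2 1"
  by (simp add: azimuthal_field_def e_theta_def vec_eq_iff forall_3 axis_def)

text \<open>
  Leaving the plane in the azimuthal direction, A changes only through the rotation of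
  e_theta.  The quotient of the first component with step h is exactly - psi(rho, z) / rho for
  rho = sqrt (x^2 + h^2), and continuity of A in the plane gives the limit.
\<close>

lemma partial_deriv_2_azimuthal_field:
  assumes diff: "\<And>X. azimuthal_field psi differentiable at X" and x: "0 < x"
  shows "partial_deriv 2 (azimuthal_field psi) (slice_pt x z) $ 3 = 0"
    and "partial_deriv 2 (azimuthal_field psi) (slice_pt x z) $ 1 = - (psi x z / x)"
proof -
  let ?A = "azimuthal_field psi" and ?X = "slice_pt x z"
  let ?h = "\<lambda>n. inverse (real (Suc n))"
  let ?q = "\<lambda>n. real (Suc n) *\<^sub>R (?A (?X + ?h n *\<^sub>R axis 2 1) - ?A ?X)"
  have lim: "?q \<longlonglongrightarrow> partial_deriv 2 ?A ?X"
    unfolding partial_deriv_def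
    by (rule difference_quotient_tendsto_frechet_derivative[OF diff]) (simp add: norm_axis_1)
  have "(\<lambda>n. ?q n $ 3) \<longlonglongrightarrow> partial_deriv 2 ?A ?X $ 3"
    using lim by (rule tendsto_vec_nth)
  moreover have "?q n $ 3 = 0" for n by (simp add: azimuthal_field_def e_theta_def)
  ultimately show "partial_deriv 2 ?A ?X $ 3 = 0"
    by (simp add: LIMSEQ_const_iff)
  \<comment> \<open>the radius of X + h e_2\<close>
  define \<rho> where "\<rho> n = sqrt (x\<^sup>2 + (?h n)\<^sup>2)" for n
  have \<rho>pos: "0 < \<rho> n" for n using x by (simp add: \<rho>_def add_pos_nonneg)
  have "\<rho> \<longlonglongrightarrow> sqrt (x\<^sup>2 + 0\<^sup>2)"
    unfolding \<rho>_def by (intro tendsto_intros LIMSEQ_inverse_real_of_nat)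
  then have \<rho>: "\<rho> \<longlonglongrightarrow> x" using x by simp
  have "(\<lambda>n. ?A (slice_pt (\<rho> n) z)) \<longlonglongrightarrow> ?A ?X"
    by (rule isCont_tendsto_compose[OF differentiable_imp_continuous_within[OF diff] tendsto_slice_pt[OF \<rho> tendsto_const]])
  then have "(\<lambda>n. ?A (slice_pt (\<rho> n) z) $ 2) \<longlonglongrightarrow> ?A ?X $ 2"
    by (rule tendsto_vec_nth)
  then have "(\<lambda>n. psi (\<rho> n) z) \<longlonglongrightarrow> psi x z"
    using x \<rho>pos by (simp add: azimuthal_field_slice_pt axis_def less_imp_neq[THEN not_sym] abs_of_pos)
  then have "(\<lambda>n. - (psi (\<rho> n) z / \<rho> n)) \<longlonglongrightarrow> - (psi x z / x)"
    using x by (intro tendsto_intros \<rho>) auto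
  moreover have "?q n $ 1 = - (psi (\<rho> n) z / \<rho> n)" for n
  proof -
    have r: "cyl_r (?X + ?h n *\<^sub>R axis 2 1) = \<rho> n"
      by (simp add: cyl_r_def \<rho>_def axis_def)
    have axis_3: "(axis 2 1 :: real^3) $ 3 = 0" by (simp add: axis_def)
    have "?A (?X + ?h n *\<^sub>R axis 2 1) $ 1 = - (psi (\<rho> n) z * (?h n / \<rho> n))"
      unfolding azimuthal_field_def r by (simp add: e_theta_def r axis_nth axis_3 del: of_nat_Suc)
    moreover have "?A ?X $ 1 = 0" by (simp add: azimuthal_field_slice_pt axis_def)
    ultimately show ?thesis by (simp del: of_nat_Suc)
  qed
  moreover have "(\<lambda>n. ?q n $ 1) \<longlonglongrightarrow> partial_deriv 2 ?A ?X $ 1"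
    using lim by (rule tendsto_vec_nth)
  ultimately show "partial_deriv 2 ?A ?X $ 1 = - (psi x z / x)"
    using LIMSEQ_unique by simp
qed

text \<open>
  In cylindrical terms u_r = - dpsi/dz and u_z = dpsi/dr + psi/r.  As psi e_theta is odd under the
  reflection x \<mapsto> -x, its difference over the segment from X to X' is 2 psi and the length of
  that segment is 2 x, which identifies the last quotient with |psi| / r.
\<close>

lemma slice_velocity_le:
  fixes x z :: real
  assumes u: "axisymmetric_no_swirl u ur uz" and curl: "\<And>X. u X = curl (azimuthal_field psi) X"
    and diff: "\<And>X. azimuthal_field psi differentiable at X" and x: "0 < x"
  defines "A \<equiv> azimuthal_field psi" and "X \<equiv> slice_pt x z" and "X' \<equiv> slice_pt (- x) z"
  shows "norm (ur x z, uz x z) \<le> norm (partial_deriv 3 A X) + norm (partial_deriv 1 A X) + norm (A X - A X') / norm (X - X')"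
proof -
  have "u X $ 1 = ur x z" "u X $ 3 = uz x z"
    using u x by (auto simp: axisymmetric_no_swirl_def X_def e_r_def e_z_def)
  then have ur: "ur x z = - partial_deriv 3 A X $ 2" and uz: "uz x z = partial_deriv 1 A X $ 2 + psi x z / x"
    using partial_deriv_2_azimuthal_field[OF diff x, of z] by (simp_all add: curl Defs.curl_def A_def X_def)
  have "A X - A X' = (2 * psi x z) *\<^sub>R axis 2 1" "X - X' = (2 * x) *\<^sub>R axis 1 1"
    using x by (simp_all add: A_def X_def X'_def azimuthal_field_slice_pt vec_eq_iff forall_3 axis_def)
  then have "norm (A X - A X') / norm (X - X') = \<bar>psi x z / x\<bar>"
    using x by (simp add: norm_axis_1)
  moreover have "norm (ur x z, uz x z) \<le> \<bar>ur x z\<bar> + \<bar>uz x z\<bar>"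
    by (simp add: norm_Pair sqrt_sum_squares_le_sum_abs)
  moreover have "\<bar>partial_deriv 3 A X $ 2\<bar> \<le> norm (partial_deriv 3 A X)" "\<bar>partial_deriv 1 A X $ 2\<bar> \<le> norm (partial_deriv 1 A X)"
    by (rule component_le_norm_cart)+
  ultimately show ?thesis using abs_triangle_ineq[of "partial_deriv 1 A X $ 2" "psi x z / x"] ur uz by simp
qed

section \<open>The velocity estimate\<close>

lemma powr_sum3_le:
  fixes a b c p :: real
  assumes "0 \<le> a" "0 \<le> b" "0 \<le> c" "0 < p"
  shows "(a + b + c) powr p \<le> 3 powr p * (a powr p + b powr p + c powr p)"
proof -
  have "(a + b + c) powr p \<le> (3 * max a (max b c)) powr p"
    using assms by (intro powr_mono2) auto
  also have "\<dots> = 3 powr p * (max a (max b c)) powr p" by (rule powr_mult)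
  also have "\<dots> \<le> 3 powr p * (a powr p + b powr p + c powr p)"
    by (intro mult_left_mono) (auto simp: max_def)
  finally show ?thesis .
qed

text \<open>
  Every quotient entering the velocity satisfies the bound of \<open>slice_Lp_estimate\<close> uniformly in the
  step 1/(n+1) \<le> 1, so Fatou's lemma bounds the velocity.  The radius L = R + 3 leaves room for one
  unit of shift of X and for the margin 2 in the splitting of the kernel.
\<close>

lemma slice_velocity_Lp_estimate:
  fixes w :: "real \<Rightarrow> real \<Rightarrow> real"
  defines "g \<equiv> \<lambda>Y. \<bar>w (cyl_r Y) (cyl_z Y) / cyl_r Y\<bar>"
  assumes R: "0 < R" "L = R + 3" and p: "1 < p"
    and u: "axisymmetric_no_swirl u ur uz" and psi: "is_stream_function psi w u"
    and F: "(\<integral>\<^sup>+Y. g Y \<partial>lborel) = ennreal F" "0 \<le> F"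
  shows "(\<integral>\<^sup>+y. ennreal (norm (ur (fst y) (snd y), uz (fst y) (snd y)) powr p) * indicator ({0..R} \<times> {-R..R}) y \<partial>lborel)
     \<le> ennreal ((41472 * L ^ 3) powr p) * (ennreal (F powr p) + (\<integral>\<^sup>+Y. ennreal (g Y powr p) \<partial>lborel))"
proof -
  define A where "A = azimuthal_field psi"
  have curl: "u X = curl A X" and C2: "C_class 2 A"
    and int: "integrable lborel (newtonian_integrand w X)"
    and rep: "A X = (\<integral>Y. newtonian_integrand w X Y \<partial>lborel)" for X
    using psi by (simp_all add: is_stream_function_def A_def newtonian_integrand_def[abs_def])
  have diff: "A differentiable at X" for X
    using C2 by (simp add: numeral_2_eq_2)
  have [measurable]: "A \<in> borel_measurable borel"
    using diff by (intro borel_measurable_continuous_onI continuous_at_imp_continuous_on)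
      (simp add: differentiable_imp_continuous_within)
  have [measurable]: "g \<in> borel_measurable borel"
    unfolding g_def by (rule vorticity_ratio_measurable[OF int])
  have g0: "0 \<le> g Y" and grot: "g (axis_rotation s Y) = g Y" for Y s
    by (simp_all add: g_def)
  let ?S = "{0<..R} \<times> {-R..R}"
  let ?h = "\<lambda>n. inverse (real (Suc n))"
  let ?P = "\<integral>\<^sup>+Y. ennreal (g Y powr p) \<partial>lborel"
  let ?B = "ennreal ((4608 * L ^ 3) powr p) * (ennreal (F powr p) + ?P)"
  define quot where "quot X X' = norm (A X - A X') / norm (X - X')" for X X'
  define q where "q c a b x z = quot (slice_pt x z) (slice_pt (c * x + a) (z + b))" for c a b x z :: real
  have q0: "0 \<le> q c a b x z" for c a b x z by (simp add: q_def quot_def)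
  have [measurable]: "(\<lambda>(x, z). q c a b x z) \<in> borel_measurable (borel \<Otimes>\<^sub>M borel)" for c a b
    unfolding q_def quot_def by measurable
  have qest: "(\<integral>\<^sup>+x. \<integral>\<^sup>+z. ennreal (q c a b x z powr p) * indicator ?S (x, z) \<partial>lborel \<partial>lborel) \<le> ?B"
    if c: "\<bar>c\<bar> = 1" and range: "\<And>x. 0 < x \<Longrightarrow> x \<le> R \<Longrightarrow> \<bar>c * x + a\<bar> \<le> R + 1"
      and neq: "\<And>x z. 0 < x \<Longrightarrow> slice_pt x z \<noteq> slice_pt (c * x + a) (z + b)" for c a b
  proof (rule slice_Lp_estimate[OF R p c _ g0 grot F q0])
    fix x z assume "x \<in> {0<..R}" "z \<in> {-R..R}"
    then show "ennreal (q c a b x z)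
        \<le> (\<integral>\<^sup>+Y. ennreal (g Y * (near_kernel L (slice_pt x z) Y + near_kernel L (slice_pt (c * x + a) (z + b)) Y)) \<partial>lborel)
         + ennreal (2 * L) * (\<integral>\<^sup>+Y. ennreal (g Y) \<partial>lborel)"
      unfolding q_def quot_def g_def
      using range[of x] neq[of x z] R by (intro newtonian_difference_quotient_le int rep) auto
  qed measurable
  \<comment> \<open>steps in z and in r, and the mirror image of X; the sum tends to the bound on the velocity\<close>
  define Q where "Q n x z = q 1 0 (?h n) x z + q 1 (?h n) 0 x z + q (-1) 0 0 x z" for n x z
  have Q0: "0 \<le> Q n x z" for n x z using q0 by (simp add: Q_def)
  have [measurable]: "(\<lambda>(x, z). Q n x z) \<in> borel_measurable (borel \<Otimes>\<^sub>M borel)" for n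
    unfolding Q_def by measurable
  have slice_neq: "slice_pt x z \<noteq> slice_pt x' z'" if "x \<noteq> x' \<or> z \<noteq> z'" for x z x' z'
    using that slice_pt_nth by metis
  have Qest: "(\<integral>\<^sup>+x. \<integral>\<^sup>+z. ennreal (Q n x z powr p) * indicator ?S (x, z) \<partial>lborel \<partial>lborel)
      \<le> ennreal (3 powr p) * (?B + ?B + ?B)" for n
  proof -
    have h: "0 < ?h n" "?h n \<le> 1" by (simp_all add: field_simps)
    have "(\<integral>\<^sup>+x. \<integral>\<^sup>+z. ennreal (Q n x z powr p) * indicator ?S (x, z) \<partial>lborel \<partial>lborel)
       \<le> (\<integral>\<^sup>+x. \<integral>\<^sup>+z. ennreal (3 powr p) * (ennreal (q 1 0 (?h n) x z powr p) * indicator ?S (x, z)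
          + ennreal (q 1 (?h n) 0 x z powr p) * indicator ?S (x, z)
          + ennreal (q (-1) 0 0 x z powr p) * indicator ?S (x, z)) \<partial>lborel \<partial>lborel)"
    proof (intro nn_integral_mono)
      fix x z :: real
      have "ennreal (Q n x z powr p) \<le> ennreal (3 powr p * (q 1 0 (?h n) x z powr p + q 1 (?h n) 0 x z powr p + q (-1) 0 0 x z powr p))"
        unfolding Q_def using p by (intro ennreal_leI powr_sum3_le q0) auto
      then show "ennreal (Q n x z powr p) * indicator ?S (x, z)
         \<le> ennreal (3 powr p) * (ennreal (q 1 0 (?h n) x z powr p) * indicator ?S (x, z)
          + ennreal (q 1 (?h n) 0 x z powr p) * indicator ?S (x, z)
          + ennreal (q (-1) 0 0 x z powr p) * indicator ?S (x, z))"
        by (cases "(x, z) \<in> ?S") (simp_all add: ennreal_mult)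
    qed
    also have "\<dots> = ennreal (3 powr p) *
         ((\<integral>\<^sup>+x. \<integral>\<^sup>+z. ennreal (q 1 0 (?h n) x z powr p) * indicator ?S (x, z) \<partial>lborel \<partial>lborel)
        + (\<integral>\<^sup>+x. \<integral>\<^sup>+z. ennreal (q 1 (?h n) 0 x z powr p) * indicator ?S (x, z) \<partial>lborel \<partial>lborel)
        + (\<integral>\<^sup>+x. \<integral>\<^sup>+z. ennreal (q (-1) 0 0 x z powr p) * indicator ?S (x, z) \<partial>lborel \<partial>lborel))"
      by (simp add: nn_integral_add nn_integral_cmult)
    also have "\<dots> \<le> ennreal (3 powr p) * (?B + ?B + ?B)"
    proof (intro mult_left_mono add_mono qest)
      show "slice_pt x z \<noteq> slice_pt (1 * x + 0) (z + ?h n)" for x z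
        using h by (intro slice_neq) simp
      show "slice_pt x z \<noteq> slice_pt (1 * x + ?h n) (z + 0)" for x z
        using h by (intro slice_neq) simp
      show "slice_pt x z \<noteq> slice_pt (-1 * x + 0) (z + 0)" if "0 < x" for x z
        using that by (intro slice_neq) simp
    qed (use h in auto)
    finally show ?thesis .
  qed
  have lim: "(\<lambda>n. Q n x z) \<longlonglongrightarrow> norm (partial_deriv 3 A (slice_pt x z)) + norm (partial_deriv 1 A (slice_pt x z))
       + quot (slice_pt x z) (slice_pt (- x) z)" for x z
  proof -
    have quot_lim: "(\<lambda>n. quot X (X + ?h n *\<^sub>R axis i 1)) \<longlonglongrightarrow> norm (partial_deriv i A X)" for X i
    proof -
      have "(\<lambda>n. norm (real (Suc n) *\<^sub>R (A (X + ?h n *\<^sub>R axis i 1) - A X))) \<longlonglongrightarrow> norm (partial_deriv i A X)"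
        unfolding partial_deriv_def
        by (intro tendsto_norm difference_quotient_tendsto_frechet_derivative diff) (simp add: norm_axis_1)
      moreover have "norm (real (Suc n) *\<^sub>R (A (X + ?h n *\<^sub>R axis i 1) - A X)) = quot X (X + ?h n *\<^sub>R axis i 1)" for n
        by (simp add: quot_def norm_axis_1 norm_minus_commute divide_inverse mult.commute del: of_nat_Suc)
      ultimately show ?thesis by simp
    qed
    have "slice_pt x z + t *\<^sub>R axis 3 1 = slice_pt x (z + t)" "slice_pt x z + t *\<^sub>R axis 1 1 = slice_pt (x + t) z" for t
      by (simp_all add: slice_pt_eq scaleR_add_left)
    then show ?thesis
      using tendsto_add[OF tendsto_add[OF quot_lim[of "slice_pt x z" 3] quot_lim[of "slice_pt x z" 1]] tendsto_const]
      by (simp add: Q_def q_def)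
  qed
  have "(\<integral>\<^sup>+y. ennreal (norm (ur (fst y) (snd y), uz (fst y) (snd y)) powr p) * indicator ({0..R} \<times> {-R..R}) y \<partial>lborel)
     \<le> (\<integral>\<^sup>+y. liminf (\<lambda>n. ennreal (Q n (fst y) (snd y) powr p) * indicator ?S y) \<partial>lborel)"
  proof (rule nn_integral_mono_AE, use AE_lborel_inner_neq[of "(1, 0) :: real \<times> real" 0] in \<open>rule eventually_mono\<close>)
    fix y :: "real \<times> real" assume "y \<bullet> (1, 0) \<noteq> 0"
    obtain x z where y: "y = (x, z)" by (cases y)
    show "ennreal (norm (ur (fst y) (snd y), uz (fst y) (snd y)) powr p) * indicator ({0..R} \<times> {-R..R}) y
       \<le> liminf (\<lambda>n. ennreal (Q n (fst y) (snd y) powr p) * indicator ?S y)"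
    proof (cases "y \<in> ?S")
      case True
      then have x: "0 < x" using y by simp
      define l where "l = norm (partial_deriv 3 A (slice_pt x z)) + norm (partial_deriv 1 A (slice_pt x z))
       + quot (slice_pt x z) (slice_pt (- x) z)"
      have "(\<lambda>n. ennreal (Q n x z powr p)) \<longlonglongrightarrow> ennreal (l powr p)"
        using lim[of x z] Q0 p unfolding l_def by (intro tendsto_ennrealI tendsto_powr') auto
      then have "liminf (\<lambda>n. ennreal (Q n x z powr p)) = ennreal (l powr p)"
        by (intro lim_imp_Liminf) auto
      moreover have "norm (ur x z, uz x z) \<le> l"
        unfolding l_def quot_def A_def
        by (rule slice_velocity_le[OF u _ _ x]) (use curl diff in \<open>simp_all add: A_def\<close>)
      then have "ennreal (norm (ur x z, uz x z) powr p) \<le> ennreal (l powr p)"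
        using p by (intro ennreal_leI powr_mono2) auto
      ultimately show ?thesis using True y by simp
    next
      case False
      then have "y \<notin> {0..R} \<times> {-R..R}" using \<open>y \<bullet> (1, 0) \<noteq> 0\<close> y by auto
      then show ?thesis by simp
    qed
  qed (simp add: Basis_prod_def)
  also have "\<dots> = (\<integral>\<^sup>+y. liminf (\<lambda>n. ennreal (Q n (fst y) (snd y) powr p) * indicator ?S y) \<partial>(lborel \<Otimes>\<^sub>M lborel))"
    by (simp add: lborel_prod)
  also have "\<dots> \<le> liminf (\<lambda>n. \<integral>\<^sup>+y. ennreal (Q n (fst y) (snd y) powr p) * indicator ?S y \<partial>(lborel \<Otimes>\<^sub>M lborel))"
    by (rule nn_integral_liminf) measurable
  also have "\<dots> \<le> ennreal (3 powr p) * (?B + ?B + ?B)"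
  proof -
    have "(\<integral>\<^sup>+y. ennreal (Q n (fst y) (snd y) powr p) * indicator ?S y \<partial>(lborel \<Otimes>\<^sub>M lborel)) \<le> ennreal (3 powr p) * (?B + ?B + ?B)" for n
      using Qest[of n] by (subst lborel.nn_integral_fst[symmetric]) simp_all
    then show ?thesis
      by (intro order_trans[OF Liminf_le_Limsup Limsup_bounded]) auto
  qed
  also have "\<dots> = ennreal (3 powr p * 3 * (4608 * L ^ 3) powr p) * (ennreal (F powr p) + ?P)"
  proof -
    have "b + b + b = ennreal 3 * b" for b :: ennreal 
    proof -
      have "b + b + b = (1 + 1 + 1) * b" by (simp only: distrib_right mult_1_left)
      then show ?thesis by simp
    qed
    then show ?thesis by (simp add: ennreal_mult mult.assoc del: ennreal_numeral)
  qed
  also have "\<dots> \<le> ennreal ((41472 * L ^ 3) powr p) * (ennreal (F powr p) + ?P)"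
  proof (intro mult_right_mono ennreal_leI)
    have "3 powr p * 3 * (4608 * L ^ 3) powr p \<le> 3 powr p * 3 powr p * (4608 * L ^ 3) powr p"
      using p powr_mono[of 1 p 3] by (intro mult_right_mono mult_left_mono) auto
    also have "\<dots> = (3 * 3 * (4608 * L ^ 3)) powr p" by (simp only: powr_mult)
    finally show "3 powr p * 3 * (4608 * L ^ 3) powr p \<le> (41472 * L ^ 3) powr p" by simp
  qed simp
  finally show ?thesis .
qed

theorem lemma3p2:
  fixes R :: real
  assumes "R > 0"
  shows "\<exists>C>0. \<forall>(u :: real^3 \<Rightarrow> real^3) (ur :: real \<Rightarrow> real \<Rightarrow> real) (uz :: real \<Rightarrow> real \<Rightarrow> real)
            (w :: real \<Rightarrow> real \<Rightarrow> real) (psi :: real \<Rightarrow> real \<Rightarrow> real) (p :: real).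
           smooth_field u \<longrightarrow>
           axisymmetric_no_swirl u ur uz \<longrightarrow>
           (\<forall>X. divergence u X = 0) \<longrightarrow>
           (\<forall>X. curl u X = azimuthal_field w X) \<longrightarrow>
           is_stream_function psi w u \<longrightarrow>
           1 < p \<longrightarrow>
           Lp_norm (restrict_space lborel ({0..R} \<times> {-R..R})) p (\<lambda>(r, z). (ur r z, uz r z))
             \<le> ennreal C * L1_Lp_norm lborel p (\<lambda>X. w (cyl_r X) (cyl_z X) / cyl_r X)"
proof -
  define M where "M = 41472 * (R + 3) ^ 3"
  have M: "0 < M" using assms by (simp add: M_def)
  show ?thesis
  proof (intro exI[of _ "2 * M"] conjI allI impI)
    show "0 < 2 * M" using M by simp
    fix u :: "real^3 \<Rightarrow> real^3" and ur uz w psi :: "real \<Rightarrow> real \<Rightarrow> real" and p :: real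
    assume u: "axisymmetric_no_swirl u ur uz" and psi: "is_stream_function psi w u" and p: "1 < p"
    define g where "g Y = \<bar>w (cyl_r Y) (cyl_z Y) / cyl_r Y\<bar>" for Y :: "real^3"
    let ?S = "{0..R} \<times> {-R..R}"
    let ?rhs = "L1_Lp_norm lborel p (\<lambda>X. w (cyl_r X) (cyl_z X) / cyl_r X)"
    have norm1: "Lp_norm lborel 1 (\<lambda>X. w (cyl_r X) (cyl_z X) / cyl_r X)
        = (if (\<integral>\<^sup>+Y. g Y \<partial>lborel) = \<infinity> then \<infinity> else ennreal (enn2real (\<integral>\<^sup>+Y. g Y \<partial>lborel)))"
      by (simp add: Lp_norm_def g_def Let_def)
    have normp: "Lp_norm lborel p (\<lambda>X. w (cyl_r X) (cyl_z X) / cyl_r X)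
        = (if (\<integral>\<^sup>+Y. ennreal (g Y powr p) \<partial>lborel) = \<infinity> then \<infinity>
           else ennreal (enn2real (\<integral>\<^sup>+Y. ennreal (g Y powr p) \<partial>lborel) powr (1 / p)))"
      by (simp add: Lp_norm_def g_def Let_def)
    show "Lp_norm (restrict_space lborel ?S) p (\<lambda>(r, z). (ur r z, uz r z)) \<le> ennreal (2 * M) * ?rhs"
    proof (cases "(\<integral>\<^sup>+Y. g Y \<partial>lborel) = \<infinity> \<or> (\<integral>\<^sup>+Y. ennreal (g Y powr p) \<partial>lborel) = \<infinity>")
      case True
      then have "?rhs = \<infinity>" unfolding L1_Lp_norm_def norm1 normp by auto
      then show ?thesis using M by (simp add: ennreal_mult_top)
    next
      case False
      define F where "F = enn2real (\<integral>\<^sup>+Y. g Y \<partial>lborel)"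
      define P where "P = enn2real (\<integral>\<^sup>+Y. ennreal (g Y powr p) \<partial>lborel)"
      define I where "I = (\<integral>\<^sup>+y. ennreal (norm ((\<lambda>(r, z). (ur r z, uz r z)) y) powr p) \<partial>restrict_space lborel ?S)"
      have F: "(\<integral>\<^sup>+Y. g Y \<partial>lborel) = ennreal F" "0 \<le> F" and P: "(\<integral>\<^sup>+Y. ennreal (g Y powr p) \<partial>lborel) = ennreal P" "0 \<le> P"
        using False by (simp_all add: F_def P_def top.not_eq_extremum)
      have S: "?S \<in> sets lborel"
        by (simp add: borel_prod[symmetric])
      have "I = (\<integral>\<^sup>+y. ennreal (norm (ur (fst y) (snd y), uz (fst y) (snd y)) powr p) * indicator ?S y \<partial>lborel)"
        unfolding I_def using S by (subst nn_integral_restrict_space) (auto simp: case_prod_beta)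
      also have "\<dots> \<le> ennreal (M powr p) * (ennreal (F powr p) + (\<integral>\<^sup>+Y. ennreal (g Y powr p) \<partial>lborel))"
        unfolding M_def g_def
        by (rule slice_velocity_Lp_estimate[OF assms refl p u psi]) (use F in \<open>simp_all add: g_def\<close>)
      also have "\<dots> = ennreal (M powr p * (F powr p + P))"
        using P by (simp add: ennreal_mult ennreal_plus)
      finally have I: "I \<le> ennreal (M powr p * (F powr p + P))" .
      \<comment> \<open>N is the p-th root of P; the factor 2 below comes from F^p + N^p \<le> 2 (F + N)^p\<close>
      define N where "N = P powr (1 / p)"
      have N: "0 \<le> N" "N powr p = P" using P p by (simp_all add: N_def powr_powr)
      have "M powr p * (F powr p + P) \<le> M powr p * (2 * (F + N) powr p)"
      proof (intro mult_left_mono)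
        have "F powr p \<le> (F + N) powr p" "N powr p \<le> (F + N) powr p"
          using F N p by (auto intro!: powr_mono2)
        then show "F powr p + P \<le> 2 * (F + N) powr p" using N by simp
      qed simp
      also have "\<dots> \<le> M powr p * (2 powr p * (F + N) powr p)"
        using p powr_mono[of 1 p 2] by (intro mult_left_mono mult_right_mono) auto
      also have "\<dots> = (2 * M * (F + N)) powr p" by (simp add: powr_mult)
      finally have "enn2real I \<le> (2 * M * (F + N)) powr p"
        using I by (intro enn2real_leI) (auto intro: order_trans ennreal_leI)
      then have "enn2real I powr (1 / p) \<le> ((2 * M * (F + N)) powr p) powr (1 / p)"
        using p by (intro powr_mono2) auto
      also have "\<dots> = 2 * M * (F + N)" using p M F N by (simp add: powr_powr)
      finally have "Lp_norm (restrict_space lborel ?S) p (\<lambda>(r, z). (ur r z, uz r z)) \<le> ennreal (2 * M * (F + N))"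
        using I by (auto simp: Lp_norm_def Let_def I_def[symmetric] top_unique intro: ennreal_leI)
      also have "\<dots> = ennreal (2 * M) * ?rhs"
        unfolding L1_Lp_norm_def norm1 normp F_def[symmetric] P_def[symmetric] N_def[symmetric]
        using False M F N by (simp add: ennreal_mult ennreal_plus)
      finally show ?thesis .
    qed
  qed
qed

end
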